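(* Let $\gamma>0$, $r>0$, $p>1$. Let $G=G(\omega)\in\mathcal H_{r,p}^{\le0,\mathcal R}$, $\omega\in\mathtt D_{\gamma,\mathcal S}$, be a Lipschitz family of Hamiltonians. Then there exists a pure constant $c>0$ such that for all $0<\delta<1$ $$\|L_\omega^{-1}G\|_{r,p+\delta}\le c\,\gamma^{-1}e^{\frac c\delta\ln^2\left(\frac1\delta\right)}\|G\|_{r,p}.$$
   Context: $\mathbb N=\{0,1,2,\dots\}$, $\langle x\rangle:=\max\{1,|x|\}$, $\lfloor j\rfloor:=\max\{2,|j|\}$, $|v|_\infty:=\sup_{j\in\mathbb Z}|v_j|$. $\mathcal S:=\{2^h: h\in\mathbb N\}\subset\mathbb Z$, $\mathcal S^c:=\mathbb Z\setminus\mathcal S$, $\mathcal Q:=\{\omega\in\mathbb R^{\mathbb Z}:|\omega_l-l^2|<\frac12\ \forall l\}$. For $p>1$, $\mathtt w_p:=\{u\in\ell^2(\mathbb C):\sup_j|u_j|\lfloor j\rfloor^p<\infty\}$, and $B_r(\mathtt w_p)$ is the ball of radius $r$ centred at $0$ for this sup norm. Diophantine condition. Fix $\tau\ge2$ ("pure constant" means a constant that may depend only on $\tau$). $\mathtt D_{\gamma,\mathcal S}$ is the set of $\omega\in\mathcal Q$ such that $$|\omega\cdot\ell|\ge\gamma\prod_{j\in\mathcal S}\frac1{(1+|\ell_j|^2\langle\log_2j\rangle^2)^\tau}$$ for all $\ell\in\mathbb Z^{\mathbb Z}$ with $0<|\ell|:=\sum_j|\ell_j|<\infty$, $\sum_{j\in\mathcal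 S^c}|\ell_j|\le2$, $\sum_jj\ell_j=0$ and $\sum_j\ell_j=0$. Regular Hamiltonians. Multi-indices $\bm\alpha,\bm\beta\in\mathbb N^{\mathbb Z}$ always have finite $|\bm\alpha|:=\sum_j\bm\alpha_j$, and $u^{\bm\alpha}:=\prod_ju_j^{\bm\alpha_j}$. Let $\mathcal M$ be the set of pairs $(\bm\alpha,\bm\beta)$ with $|\bm\alpha|=|\bm\beta|<\infty$ and $\sum_jj(\bm\alpha_j-\bm\beta_j)=0$. $\mathcal H_{r,p}$ is the space of formal power series $H=\sum_{(\bm\alpha,\bm\beta)\in\mathcal M}H_{\bm\alpha,\bm\beta}u^{\bm\alpha}\bar u^{\bm\beta}$ with $H_{\bm\alpha,\bm\beta}=\overline{H_{\bm\beta,\bm\alpha}}$ and $$|H|_{r,p}:=\tfrac12\sup_j\sum_{(\bm\alpha,\bm\beta)\in\mathcal M}|H_{\bm\alpha,\bm\beta}|(\bm\alpha_j+\bm\beta_j)\,u_p^{\bm\alpha+\bm\beta-2e_j}<\infty,\qquad u_{p,j}:=r\lfloor j\rfloor^{-p}.$$ For a family $H(\omega)\in\mathcal H_{r,p}$, $\omega\in\mathtt D_{\gamma,\mathcal S}$, $$\|H\|_{r,p}:=\sup_{\omega}|H(\omega)|_{r,p}+\gamma\sup_{\omega\ne\omega'}\frac{|H(\omega)-H(\omega')|_{r,p}}{|\omega-\omega'|_\infty},$$ suprema over $\mathtt D_{\gamma,\mathcal S}$; the family is Lipschitz if this is finite. Degree decomposition. Fix $I=(I_j)_{j\in\mathbb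 Z}$, $I_j\ge0$, with $(\sqrt{I_j})_j\in B_r(\mathtt w_p)$ and $I_j=0$ for $j\in\mathcal S^c$. Write $u=(v,z)$ with $v=(u_j)_{j\in\mathcal S}$, $z=(u_j)_{j\in\mathcal S^c}$, and rewrite $H=\sum H_{m,\alpha,\beta,a,b}|v|^{2m}v^\alpha\bar v^\beta z^a\bar z^b$, sum over $m,\alpha,\beta\in\mathbb N^{\mathcal S}$ with $\alpha,\beta$ of disjoint supports and $a,b\in\mathbb N^{\mathcal S^c}$. For integers $d\ge-2$, $$H^{(d)}:=\sum_{\delta\preceq m,\ 2|\delta|+|a|+|b|=d+2}H_{m,\alpha,\beta,a,b}\binom m\delta I^{m-\delta}(|v|^2-I)^\delta v^\alpha\bar v^\beta z^a\bar z^b$$ (here $\delta\in\mathbb N^{\mathcal S}$ is a multi-index, $|v|^2=(|v_j|^2)_{j\in\mathcal S}$, $I=(I_j)_{j\in\mathcal S}$, and $\delta\preceq m$ is componentwise). $\mathcal H_{r,p}^{\le0,\mathcal R}$ is the set of $G\in\mathcal H_{r,p}$ with $G=G^{(-2)}+G^{(-1)}+G^{(0)}$ and $G_{\bm\alpha,\bm\alpha}=0$ for every $\bm\alpha\in\mathbb N^{\mathbb Z}$. Inverse Lie derivative. For such $G$, $$L_\omega^{-1}G:=\sum_{(\bm\alpha,\bm\beta)\in\mathcal M,\ \bm\alpha\ne\bm\beta}\frac{G_{\bm\alpha,\bm\beta}}{\mathrm i\,\omega\cdot(\bm\alpha-\bm\beta)}u^{\bm\alpha}\bar u^{\bm\beta},$$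 the formal inverse of $L_\omega:=\{\sum_j\omega_j|u_j|^2,\cdot\}$ on Hamiltonians without terms $\bm\alpha=\bm\beta$; in $\|L_\omega^{-1}G\|_{r,p+\delta}$ it is regarded as a family in $\omega\in\mathtt D_{\gamma,\mathcal S}$. *)

theory Defs
  imports "HOL-Analysis.Analysis"
begin

definition supp :: "(int \<Rightarrow> 'a::zero) \<Rightarrow> int set" where
  "supp f = {j. f j \<noteq> 0}"

text \<open>Multi-indices are functions on the integers of finite support; for
  natural-number valued functions this is equivalent to finite total degree.\<close>

type_synonym mindex = "int \<Rightarrow> nat"

definition mindices :: "mindex set" where
  "mindices = {\<alpha>. finite (supp \<alpha>)}"

definition deg :: "mindex \<Rightarrow> nat" where
  "deg \<alpha> = (\<Sum>j\<in>supp \<alpha>. \<alpha> j)"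

definition mpow :: "(int \<Rightarrow> real) \<Rightarrow> mindex \<Rightarrow> real" where
  "mpow x \<alpha> = (\<Prod>j\<in>supp \<alpha>. x j ^ \<alpha> j)"

definition mbinom :: "mindex \<Rightarrow> mindex \<Rightarrow> nat" where
  "mbinom m \<delta> = (\<Prod>j\<in>supp \<delta>. m j choose \<delta> j)"

definition jap :: "real \<Rightarrow> real" where
  "jap x = max 1 \<bar>x\<bar>"

definition fbr :: "int \<Rightarrow> real" where
  "fbr j = max 2 \<bar>real_of_int j\<bar>"

definition S :: "int set" where
  "S = range (\<lambda>h::nat. 2 ^ h)"

definition Q :: "(int \<Rightarrow> real) set" where
  "Q = {\<omega>. \<forall>l. \<bar>\<omega> l - (real_of_int l)\<^sup>2\<bar> < 1 / 2}"

definition wp :: "real \<Rightarrow> (int \<Rightarrow> complex) set" where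
  "wp p = {u. (\<lambda>j. (cmod (u j))\<^sup>2) summable_on UNIV \<and>
              bdd_above (range (\<lambda>j. cmod (u j) * fbr j powr p))}"

definition wp_ball :: "real \<Rightarrow> real \<Rightarrow> (int \<Rightarrow> complex) set" where
  "wp_ball r p = {u \<in> wp p. (SUP j. cmod (u j) * fbr j powr p) < r}"

definition freq_dot :: "(int \<Rightarrow> real) \<Rightarrow> (int \<Rightarrow> int) \<Rightarrow> real" where
  "freq_dot \<omega> l = (\<Sum>j\<in>supp l. \<omega> j * real_of_int (l j))"

text \<open>The sums and the product over \<open>j\<close> are restricted to the support of
  the integer vector \<open>l\<close>: all other terms are 0, all other factors are 1.\<close>

definition diophantine :: "real \<Rightarrow> real \<Rightarrow> (int \<Rightarrow> real) set" where
  "diophantine \<tau> \<gamma> = {\<omega> \<in> Q. \<forall>l :: int \<Rightarrow> int.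
     finite (supp l) \<and> 0 < (\<Sum>j\<in>supp l. \<bar>l j\<bar>) \<and>
     (\<Sum>j\<in>supp l - S. \<bar>l j\<bar>) \<le> 2 \<and>
     (\<Sum>j\<in>supp l. j * l j) = 0 \<and> (\<Sum>j\<in>supp l. l j) = 0 \<longrightarrow>
     \<gamma> * (\<Prod>j\<in>supp l \<inter> S.
            1 / (1 + \<bar>real_of_int (l j)\<bar>\<^sup>2 * (jap (log 2 (real_of_int j)))\<^sup>2) powr \<tau>)
       \<le> \<bar>freq_dot \<omega> l\<bar>}"

text \<open>A formal power series in \<open>u\<close> and its conjugate is represented by its
  coefficient function; coefficients outside \<open>M\<close> are required to vanish.\<close>

type_synonym ham = "mindex \<Rightarrow> mindex \<Rightarrow> complex"

definition M :: "(mindex \<times> mindex) set" where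
  "M = {(\<alpha>, \<beta>). \<alpha> \<in> mindices \<and> \<beta> \<in> mindices \<and> deg \<alpha> = deg \<beta> \<and>
         (\<Sum>j\<in>supp \<alpha> \<union> supp \<beta>. j * (int (\<alpha> j) - int (\<beta> j))) = 0}"

definition u_weight :: "real \<Rightarrow> real \<Rightarrow> int \<Rightarrow> real" where
  "u_weight r p j = r * fbr j powr (- p)"

text \<open>Integer exponents, as the exponent \<open>\<alpha> + \<beta> - 2 e\<^sub>j\<close> in the norm below
  can be negative at \<open>j\<close>.\<close>

definition zpow :: "(int \<Rightarrow> real) \<Rightarrow> (int \<Rightarrow> int) \<Rightarrow> real" where
  "zpow x k = (\<Prod>i\<in>supp k. x i powi k i)"

definition ham_norm :: "real \<Rightarrow> real \<Rightarrow> ham \<Rightarrow> ennreal" where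
  "ham_norm r p H = ennreal (1 / 2) *
     (SUP j. \<Sum>\<^sub>\<infinity>(\<alpha>, \<beta>)\<in>M. ennreal (cmod (H \<alpha> \<beta>) * real (\<alpha> j + \<beta> j) *
        zpow (u_weight r p) (\<lambda>i. int (\<alpha> i) + int (\<beta> i) - (if i = j then 2 else 0))))"

definition ham_space :: "real \<Rightarrow> real \<Rightarrow> ham set" where
  "ham_space r p = {H. (\<forall>\<alpha> \<beta>. (\<alpha>, \<beta>) \<notin> M \<longrightarrow> H \<alpha> \<beta> = 0) \<and>
     (\<forall>\<alpha> \<beta>. H \<alpha> \<beta> = cnj (H \<beta> \<alpha>)) \<and> ham_norm r p H < \<infinity>}"

definition dist_sup :: "(int \<Rightarrow> real) \<Rightarrow> (int \<Rightarrow> real) \<Rightarrow> ennreal" where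
  "dist_sup \<omega> \<omega>' = (SUP j. ennreal \<bar>\<omega> j - \<omega>' j\<bar>)"

definition lip_norm ::
  "real \<Rightarrow> real \<Rightarrow> real \<Rightarrow> real \<Rightarrow> ((int \<Rightarrow> real) \<Rightarrow> ham) \<Rightarrow> ennreal" where
  "lip_norm \<tau> \<gamma> r p H =
     (SUP \<omega>\<in>diophantine \<tau> \<gamma>. ham_norm r p (H \<omega>)) +
     ennreal \<gamma> *
     (SUP (\<omega>, \<omega>')\<in>{(\<omega>, \<omega>'). \<omega> \<in> diophantine \<tau> \<gamma> \<and> \<omega>' \<in> diophantine \<tau> \<gamma> \<and> \<omega> \<noteq> \<omega>'}.
        ham_norm r p (\<lambda>\<alpha> \<beta>. H \<omega> \<alpha> \<beta> - H \<omega>' \<alpha> \<beta>) / dist_sup \<omega> \<omega>')"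

text \<open>Coefficient at \<open>(A, B)\<close> of the polynomial
  \<open>(|v|\<^sup>2 - I)\<^sup>\<delta> v\<^sup>\<alpha> (cnj v)\<^sup>\<beta> z\<^sup>a (cnj z)\<^sup>b\<close>, by the binomial expansion of its first factor.\<close>

definition centred_coeff ::
  "(int \<Rightarrow> real) \<Rightarrow> mindex \<Rightarrow> mindex \<Rightarrow> mindex \<Rightarrow> mindex \<Rightarrow> mindex \<Rightarrow> ham" where
  "centred_coeff I \<delta> \<alpha> \<beta> a b A B =
     (\<Sum>k | k \<le> \<delta> \<and> A = (\<lambda>j. k j + \<alpha> j + a j) \<and> B = (\<lambda>j. k j + \<beta> j + b j).
        of_nat (mbinom \<delta> k) * of_real (mpow (\<lambda>j. - I j) (\<lambda>j. \<delta> j - k j)))"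

definition deg_indices ::
  "int \<Rightarrow> (mindex \<times> mindex \<times> mindex \<times> mindex \<times> mindex \<times> mindex) set" where
  "deg_indices d = {(m, \<alpha>, \<beta>, a, b, \<delta>).
     {m, \<alpha>, \<beta>, a, b, \<delta>} \<subseteq> mindices \<and>
     supp m \<subseteq> S \<and> supp \<alpha> \<subseteq> S \<and> supp \<beta> \<subseteq> S \<and> supp \<delta> \<subseteq> S \<and>
     supp a \<subseteq> - S \<and> supp b \<subseteq> - S \<and> supp \<alpha> \<inter> supp \<beta> = {} \<and>
     \<delta> \<le> m \<and> int (2 * deg \<delta> + deg a + deg b) = d + 2}"

text \<open>The coefficient of \<open>|v|\<^sup>2\<^sup>m v\<^sup>\<alpha> (cnj v)\<^sup>\<beta> z\<^sup>a (cnj z)\<^sup>b\<close> in \<open>H\<close> is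
  \<open>H (m + \<alpha> + a) (m + \<beta> + b)\<close>.\<close>

definition deg_part :: "(int \<Rightarrow> real) \<Rightarrow> int \<Rightarrow> ham \<Rightarrow> ham" where
  "deg_part I d H A B =
     (\<Sum>\<^sub>\<infinity>(m, \<alpha>, \<beta>, a, b, \<delta>)\<in>deg_indices d.
        H (\<lambda>j. m j + \<alpha> j + a j) (\<lambda>j. m j + \<beta> j + b j) *
        of_nat (mbinom m \<delta>) * of_real (mpow I (\<lambda>j. m j - \<delta> j)) *
        centred_coeff I \<delta> \<alpha> \<beta> a b A B)"

definition ham_le0_range :: "(int \<Rightarrow> real) \<Rightarrow> real \<Rightarrow> real \<Rightarrow> ham set" where
  "ham_le0_range I r p = {G \<in> ham_space r p.
     (\<forall>\<alpha> \<beta>. G \<alpha> \<beta> = deg_part I (-2) G \<alpha> \<beta> + deg_part I (-1) G \<alpha> \<beta> + deg_part I 0 G \<alpha> \<beta>) \<and>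
     (\<forall>\<alpha>. G \<alpha> \<alpha> = 0)}"

definition lie_inv :: "(int \<Rightarrow> real) \<Rightarrow> ham \<Rightarrow> ham" where
  "lie_inv \<omega> G \<alpha> \<beta> =
     (if (\<alpha>, \<beta>) \<in> M \<and> \<alpha> \<noteq> \<beta>
      then G \<alpha> \<beta> / (\<i> * of_real (freq_dot \<omega> (\<lambda>j. int (\<alpha> j) - int (\<beta> j))))
      else 0)"

end

theory Submission imports Defs begin

text \<open>Write \<open>l = \<alpha> - \<beta>\<close> and split off from \<open>\<alpha> + \<beta>\<close> its two modes of largest modulus, leaving
  a multi-index \<open>\<kappa>\<close> of logarithmic size \<open>D = \<Sum>\<kappa>\<^sub>i ln \<lfloor>i\<rfloor>\<close>. Passing from \<open>p\<close> to \<open>p + \<delta>\<close>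
  divides the weight of the monomial by the power \<open>\<delta>\<close> of the product of all \<open>\<lfloor>i\<rfloor>\<close>, and multiplies it
  by \<open>\<lfloor>j\<rfloor>\<close> to the power \<open>2 \<delta>\<close>. By momentum conservation the two largest modes are comparable up to a
  factor controlled by \<open>\<kappa>\<close>, so they compensate \<open>\<lfloor>j\<rfloor>\<close> and a gain of order \<open>exp (- \<delta> D / 2)\<close> remains.

  Since \<open>\<omega>\<^sub>j\<close> is close to \<open>j\<^sup>2\<close>, the divisor \<open>\<omega> \<cdot> l\<close> has modulus at least \<open>1\<close> unless the two largest
  modes cancel in \<open>l\<close> or have modulus at most \<open>4 exp (3 D)\<close>; hence they contribute only a power of
  \<open>1 + D\<close> to the Diophantine lower bound. The other factors of that bound are indexed by \<open>j = 2\<^sup>h\<close>.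
  The gain beats each of them once \<open>h\<close> exceeds a multiple of \<open>ln (1 / \<delta>) / \<delta>\<close>, and each of the
  remaining ones costs a power of \<open>1 / \<delta>\<close>: this is the factor \<open>exp (c / \<delta> ln\<^sup>2 (1 / \<delta>))\<close>.\<close>

section \<open>Logarithmic size of a multi-index and the Diophantine product\<close>

definition mode_height :: "int \<Rightarrow> real" where
  "mode_height j = jap (log 2 (real_of_int j))"

definition log_size :: "mindex \<Rightarrow> real" where
  "log_size \<kappa> = (\<Sum>i\<in>supp \<kappa>. real (\<kappa> i) * ln (fbr i))"

text \<open>For an integer vector, its power - \<tau> is the Diophantine lower bound divided by
  \<gamma>. The argument is real so that integer vectors and multi-indices can be compared.\<close>

definition divisor_prod :: "(int \<Rightarrow> real) \<Rightarrow> real" where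
  "divisor_prod x = (\<Prod>j\<in>supp x \<inter> S. 1 + (x j)\<^sup>2 * (mode_height j)\<^sup>2)"

lemma fbr_ge_2: "2 \<le> fbr j"
  by (simp add: fbr_def)

lemma fbr_ge_abs: "\<bar>real_of_int j\<bar> \<le> fbr j"
  by (simp add: fbr_def)

lemma fbr_pos: "0 < fbr j"
  using fbr_ge_2[of j] by linarith

lemma fbr_mono: "\<bar>i\<bar> \<le> \<bar>j\<bar> \<Longrightarrow> fbr i \<le> fbr j"
  by (auto simp: fbr_def max_def)

lemma ln_fbr_ge: "ln 2 \<le> ln (fbr j)"
  using fbr_ge_2[of j] by simp

lemma ln_fbr_ge_two_thirds: "2 / 3 \<le> ln (fbr j)"
  using ln_fbr_ge[of j] ln2_ge_two_thirds by linarith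

lemma mode_height_ge_1: "1 \<le> mode_height j"
  by (simp add: mode_height_def jap_def)

lemma mode_height_power: "mode_height (2 ^ h) = max 1 (real h)"
  by (simp add: mode_height_def jap_def)

text \<open>The cutoff 2 in \<open>fbr\<close> and the cutoff 1 in \<open>jap\<close> match, so that
  even \<open>j = 1\<close> fits. This is how logarithmic size controls the heights in the
  Diophantine product.\<close>

lemma ln_fbr_S:
  assumes "j \<in> S"
  shows "ln (fbr j) = ln 2 * mode_height j"
proof -
  obtain h :: nat where j: "j = 2 ^ h"
    using assms by (auto simp: S_def)
  show ?thesis
  proof (cases "h = 0")
    case True
    then show ?thesis
      using mode_height_power[of 0] by (simp add: j fbr_def)
  next
    case False
    then have "(2::real) ^ 1 \<le> 2 ^ h"
      by (intro power_increasing) auto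
    then have "fbr j = 2 ^ h" by (simp add: j fbr_def)
    then show ?thesis
      using False by (simp add: j mode_height_power ln_realpow max_def)
  qed
qed

lemma mode_height_le:
  assumes "j \<in> S" "\<bar>real_of_int j\<bar> \<le> exp x" "1 \<le> y" "x / ln 2 \<le> y"
  shows "mode_height j \<le> y"
proof -
  have "0 < j" using assms(1) by (auto simp: S_def)
  then have "ln (real_of_int j) \<le> x"
    using assms(2) ln_le_cancel_iff[of "real_of_int j" "exp x"] by simp
  moreover have "0 \<le> ln (real_of_int j)" using \<open>0 < j\<close> by simp
  ultimately show ?thesis
    using assms(3,4) by (auto simp: mode_height_def jap_def log_def intro: order_trans[OF divide_right_mono])
qed

lemma supp_subset_iff: "supp f \<subseteq> F \<longleftrightarrow> (\<forall>j. j \<notin> F \<longrightarrow> f j = 0)"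
  by (auto simp: supp_def)

lemma log_size_eq:
  assumes "finite F" "supp \<kappa> \<subseteq> F"
  shows "log_size \<kappa> = (\<Sum>i\<in>F. real (\<kappa> i) * ln (fbr i))"
  unfolding log_size_def
  by (rule sum.mono_neutral_left) (use assms in \<open>auto simp: supp_def\<close>)

lemma divisor_prod_eq:
  assumes "finite F" "supp x \<subseteq> F"
  shows "divisor_prod x = (\<Prod>j\<in>F \<inter> S. 1 + (x j)\<^sup>2 * (mode_height j)\<^sup>2)"
  unfolding divisor_prod_def
  by (rule prod.mono_neutral_left) (use assms in \<open>auto simp: supp_def\<close>)

lemma log_size_nonneg: "0 \<le> log_size \<kappa>"
  unfolding log_size_def
  by (intro sum_nonneg mult_nonneg_nonneg) (use ln_fbr_ge_two_thirds in \<open>auto intro: order_trans[of _ "2/3"]\<close>)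

lemma divisor_prod_ge_1: "1 \<le> divisor_prod x"
  unfolding divisor_prod_def by (rule prod_ge_1) simp

section \<open>Inequalities for logarithms, products and logarithmic size\<close>

text \<open>The tangent bound \<open>ln t \<le> t - 1\<close> at \<open>t = x / s\<close>. With
  \<open>s\<close> proportional to \<open>1 / \<delta>\<close>, a logarithm costs a small multiple
  of \<open>\<delta> * x\<close>, plus \<open>ln (1 / \<delta>)\<close> and a constant.\<close>

lemma ln_le_linear:
  fixes x s :: real
  assumes "0 < s" "0 < x"
  shows "ln x \<le> x / s + ln s"
  using ln_le_minus_one[of "x / s"] assms by (simp add: ln_div)

lemma one_plus_sum_le_prod:
  fixes f :: "'a \<Rightarrow> real"
  assumes "finite F" "\<And>i. i \<in> F \<Longrightarrow> 0 \<le> f i"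
  shows "1 + sum f F \<le> (\<Prod>i\<in>F. 1 + f i)"
  using assms
proof (induction F rule: finite_induct)
  case empty
  then show ?case by simp
next
  case (insert a F)
  have "0 \<le> f a * sum f F"
    using insert.prems by (intro mult_nonneg_nonneg sum_nonneg) auto
  then have "1 + sum f (insert a F) \<le> (1 + f a) * (1 + sum f F)"
    using insert.hyps by (simp add: algebra_simps)
  also have "\<dots> \<le> (1 + f a) * (\<Prod>i\<in>F. 1 + f i)"
    using insert by (intro mult_left_mono) (auto intro: add_nonneg_nonneg)
  finally show ?case using insert.hyps by simp
qed

text \<open>Factor by factor: Bernoulli moves \<open>\<kappa> i\<close> into the exponent, and
  \<open>1 + x\<^sup>2 \<le> x ^ 3\<close> for \<open>x \<ge> 2\<close> produces the 3.\<close>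

lemma one_plus_square_sum_le_exp:
  assumes "finite F" "supp \<kappa> \<subseteq> F"
  shows "1 + (\<Sum>i\<in>F. real (\<kappa> i) * (fbr i)\<^sup>2) \<le> exp (3 * log_size \<kappa>)"
proof -
  have "1 + (\<Sum>i\<in>F. real (\<kappa> i) * (fbr i)\<^sup>2) \<le> (\<Prod>i\<in>F. 1 + real (\<kappa> i) * (fbr i)\<^sup>2)"
    using assms(1) by (intro one_plus_sum_le_prod) auto
  also have "\<dots> \<le> (\<Prod>i\<in>F. exp (3 * (real (\<kappa> i) * ln (fbr i))))"
  proof (rule prod_mono, safe)
    fix i
    let ?x = "fbr i"
    show "0 \<le> 1 + real (\<kappa> i) * ?x\<^sup>2" by simp
    have x: "2 \<le> ?x" by (rule fbr_ge_2)
    have "1 + ?x ^ 2 \<le> ?x ^ 2 + ?x ^ 2"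
      using x one_le_power[of ?x 2] by linarith
    also have "\<dots> = 2 * ?x ^ 2" by simp
    also have "\<dots> \<le> ?x * ?x ^ 2" using x by (intro mult_right_mono) auto
    finally have *: "1 + ?x\<^sup>2 \<le> ?x ^ 3" by (simp add: power2_eq_square power3_eq_cube)
    have "1 + real (\<kappa> i) * ?x\<^sup>2 \<le> (1 + ?x\<^sup>2) ^ \<kappa> i"
      by (rule Bernoulli_inequality) (rule order_trans[of _ 0], auto)
    also have "\<dots> \<le> (?x ^ 3) ^ \<kappa> i"
      using * by (intro power_mono) auto
    also have "\<dots> = exp (3 * (real (\<kappa> i) * ln ?x))"
    proof -
      have "exp (3 * (real (\<kappa> i) * ln ?x)) = exp (real (3 * \<kappa> i) * ln ?x)" by simp
      also have "\<dots> = ?x ^ (3 * \<kappa> i)"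
        using fbr_pos[of i] by (simp only: exp_of_nat_mult exp_ln)
      finally show ?thesis by (simp add: power_mult)
    qed
    finally show "1 + real (\<kappa> i) * ?x\<^sup>2 \<le> exp (3 * (real (\<kappa> i) * ln ?x))" .
  qed
  also have "\<dots> = exp (3 * log_size \<kappa>)"
    by (simp add: log_size_eq[OF assms] exp_sum[OF assms(1)] sum_distrib_left)
  finally show ?thesis .
qed

lemma total_degree_le_log_size:
  assumes "finite F" "supp \<kappa> \<subseteq> F"
  shows "(\<Sum>i\<in>F. real (\<kappa> i)) * (2 / 3) \<le> log_size \<kappa>"
  unfolding log_size_eq[OF assms] sum_distrib_right
  by (intro sum_mono mult_left_mono ln_fbr_ge_two_thirds) auto

section \<open>The exponential gain against powers of the small divisors\<close>

text \<open>At height at least \<open>2 * \<Lambda> / \<epsilon>\<close> a spare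
  \<open>\<epsilon> * y / 2\<close> absorbs \<Lambda>. Lower heights belong to powers
  \<open>2 ^ h\<close> with \<open>h < 2 * \<Lambda> / \<epsilon>\<close>; there are at most
  \<open>2 * \<Lambda> / \<epsilon> + 1\<close> of them, and each costs \<Lambda>.\<close>

lemma divisor_prod_exp_bound:
  fixes \<kappa> :: mindex and b \<epsilon> \<Lambda> :: real
  assumes fin: "finite (supp \<kappa>)" and "0 < \<epsilon>" "0 \<le> \<Lambda>"
    and bound: "\<And>y. 0 \<le> y \<Longrightarrow> b * ln (1 + y\<^sup>2) \<le> \<Lambda> + \<epsilon> * y / 2"
  shows "b * ln (divisor_prod (\<lambda>j. real (\<kappa> j))) \<le> 2 * \<epsilon> * log_size \<kappa> + \<Lambda> * (2 * \<Lambda> / \<epsilon> + 1)"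
proof -
  let ?F = "supp \<kappa> \<inter> S"
  let ?y = "\<lambda>j. real (\<kappa> j) * mode_height j"
  let ?B = "{j \<in> ?F. mode_height j < 2 * \<Lambda> / \<epsilon>}"
  have y: "mode_height j \<le> ?y j" if "j \<in> supp \<kappa>" for j
  proof -
    have "1 * mode_height j \<le> ?y j"
      using that mode_height_ge_1[of j] by (intro mult_right_mono) (auto simp: supp_def)
    then show ?thesis by simp
  qed
  have "supp (\<lambda>j. real (\<kappa> j)) = supp \<kappa>" by (simp add: supp_def)
  then have "b * ln (divisor_prod (\<lambda>j. real (\<kappa> j))) = (\<Sum>j\<in>?F. b * ln (1 + (?y j)\<^sup>2))"
    using fin by (simp add: divisor_prod_def ln_prod sum_distrib_left power_mult_distrib add_pos_nonneg
      add_nonneg_eq_0_iff)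
  also have "\<dots> \<le> (\<Sum>j\<in>?F. \<epsilon> * ?y j + (if j \<in> ?B then \<Lambda> else 0))"
  proof (rule sum_mono)
    fix j assume j: "j \<in> ?F"
    have h: "mode_height j \<le> ?y j" using y j by blast
    have 1: "b * ln (1 + (?y j)\<^sup>2) \<le> \<Lambda> + \<epsilon> * ?y j / 2"
      using h mode_height_ge_1[of j] by (intro bound) linarith
    have 2: "\<epsilon> * mode_height j \<le> \<epsilon> * ?y j"
      using h \<open>0 < \<epsilon>\<close> by simp
    have 3: "0 \<le> \<epsilon> * ?y j"
      using h mode_height_ge_1[of j] \<open>0 < \<epsilon>\<close> by (intro mult_nonneg_nonneg) linarith+
    show "b * ln (1 + (?y j)\<^sup>2) \<le> \<epsilon> * ?y j + (if j \<in> ?B then \<Lambda> else 0)"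
    proof (cases "j \<in> ?B")
      case True
      show ?thesis unfolding if_P[OF True] using 1 3 by linarith
    next
      case False
      have "2 * \<Lambda> \<le> \<epsilon> * mode_height j"
        using False j \<open>0 < \<epsilon>\<close> by (auto simp: field_simps not_less)
      then show ?thesis unfolding if_not_P[OF False] using 1 2 by linarith
    qed
  qed
  also have "\<dots> = (\<Sum>j\<in>?F. \<epsilon> * ?y j) + \<Lambda> * real (card ?B)"
    using fin by (simp add: sum.distrib sum.If_cases Int_def conj_commute cong: conj_cong)
  also have "(\<Sum>j\<in>?F. \<epsilon> * ?y j) \<le> 2 * \<epsilon> * log_size \<kappa>"
  proof -
    have "(\<Sum>j\<in>?F. \<epsilon> * ?y j) \<le> (\<Sum>j\<in>?F. 2 * \<epsilon> * (real (\<kappa> j) * ln (fbr j)))"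
    proof (rule sum_mono)
      fix j assume j: "j \<in> ?F"
      have "0 \<le> \<epsilon> * ?y j"
        using mode_height_ge_1[of j] \<open>0 < \<epsilon>\<close> by simp
      \<comment> \<open>As \<open>ln 2 \<ge> 2 / 3\<close>, a height is at most
        \<open>2 * ln (fbr j)\<close>; this is the 2 in front of \<epsilon>.\<close>
      from mult_right_mono[OF ln2_ge_two_thirds this]
      show "\<epsilon> * ?y j \<le> 2 * \<epsilon> * (real (\<kappa> j) * ln (fbr j))"
        using j \<open>0 \<le> \<epsilon> * ?y j\<close> by (simp add: ln_fbr_S algebra_simps)
    qed
    also have "\<dots> \<le> (\<Sum>j\<in>supp \<kappa>. 2 * \<epsilon> * (real (\<kappa> j) * ln (fbr j)))"
      using fin \<open>0 < \<epsilon>\<close> ln_fbr_ge_two_thirds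
      by (intro sum_mono2 mult_nonneg_nonneg) (auto intro: order_trans[of _ "2/3"])
    finally show ?thesis by (simp add: log_size_def sum_distrib_left)
  qed
  also have "real (card ?B) \<le> 2 * \<Lambda> / \<epsilon> + 1"
  proof -
    let ?N = "nat \<lceil>2 * \<Lambda> / \<epsilon>\<rceil>"
    have "?B \<subseteq> (\<lambda>h. 2 ^ h) ` {..<?N}"
    proof
      fix j assume j: "j \<in> ?B"
      then obtain h :: nat where h: "j = 2 ^ h" by (auto simp: S_def)
      with j have "real h < 2 * \<Lambda> / \<epsilon>" by (simp add: mode_height_power)
      then have "h < ?N" by linarith
      then show "j \<in> (\<lambda>h. 2 ^ h) ` {..<?N}" using h by blast
    qed
    then have "card ?B \<le> card ((\<lambda>h. 2 ^ h :: int) ` {..<?N})"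
      by (intro card_mono) auto
    also have "\<dots> \<le> ?N" using card_image_le[of "{..<?N}"] by simp
    finally have "real (card ?B) \<le> real ?N" by simp
    also have "\<dots> \<le> 2 * \<Lambda> / \<epsilon> + 1"
      using \<open>0 < \<epsilon>\<close> \<open>0 \<le> \<Lambda>\<close> by (simp add: of_nat_nat ceiling_le_iff)
    finally show ?thesis .
  qed
  finally show ?thesis using \<open>0 \<le> \<Lambda>\<close> by (simp add: mult_left_mono)
qed

text \<open>\<open>4 * 10 powr \<tau>\<close> is an upper bound for \<gamma>, which serves divisors
  of modulus at least 1. The other factor dominates the Diophantine product of \<alpha> - \<beta>
  when the divisor is below 1; its fourth power is the price of the two largest modes.\<close>

definition divisor_bound :: "real \<Rightarrow> mindex \<Rightarrow> real" where
  "divisor_bound \<tau> \<kappa> = 4 * 10 powr \<tau> *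
     (16 * (2 + 5 * log_size \<kappa>) ^ 4 * divisor_prod (\<lambda>j. real (\<kappa> j))) powr \<tau>"

text \<open>The left side is what a Lipschitz quotient demands: the weight ratio, a bound for the
  total modulus of \<alpha> - \<beta>, and two inverse divisors. With \<open>D\<close> the
  logarithmic size, the gain \<open>\<delta> * D / 2\<close> is spent in two halves, one on the
  powers of \<open>2 + 5 * D\<close>, one on \<open>divisor_prod\<close>.\<close>

lemma divisor_bound_weight_le:
  fixes \<tau> :: real
  assumes "1 \<le> \<tau>"
  shows "\<exists>C\<ge>0. \<forall>\<delta> \<kappa>. 0 < \<delta> \<longrightarrow> \<delta> < 1 \<longrightarrow> finite (supp \<kappa>) \<longrightarrow>
    3 * exp (- \<delta> * log_size \<kappa> / 2) * (2 + 5 * log_size \<kappa>) * (divisor_bound \<tau> \<kappa>)\<^sup>2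
      \<le> exp (C * (1 + ln (1 / \<delta>))\<^sup>2 / \<delta>)"
proof -
  \<comment> \<open>\<open>a\<close> is the total exponent of \<open>2 + 5 * D\<close>: 1 from the
    explicit factor and \<open>2 * 4 * \<tau>\<close> from the squared \<open>divisor_bound\<close>.
    \<open>K0\<close> is the logarithm of all numerical factors, and \<open>C1\<close> is made for
    \<open>\<Lambda> \<le> C1 * (1 + L)\<close>.\<close>
  define a where "a = 1 + 8 * \<tau>"
  define K0 where "K0 = ln 3 + 2 * ln 4 + 2 * \<tau> * ln 10 + 2 * \<tau> * ln (16::real)"
  define C1 where "C1 = 1 + 4 * \<tau> * (ln (64 * \<tau>) + 1)"
  define C where "C = K0 + 1 + a * (ln (20 * a) + 1) + 17 * C1\<^sup>2"
  have a: "0 < a" "0 \<le> ln (20 * a)" and K0: "0 \<le> K0"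
    using assms by (auto simp: a_def K0_def)
  have ln64: "0 \<le> ln (64 * \<tau>)" using assms by simp
  have C1: "1 \<le> C1" using assms ln64 by (simp add: C1_def)
  have "0 \<le> C" using a K0 by (simp add: C_def)
  moreover
  {
    fix \<delta> :: real and \<kappa> :: mindex
    assume \<delta>: "0 < \<delta>" "\<delta> < 1" and fin: "finite (supp \<kappa>)"
    define D where "D = log_size \<kappa>"
    define P where "P = divisor_prod (\<lambda>j. real (\<kappa> j))"
    define L where "L = ln (1 / \<delta>)"
    define \<Lambda> where "\<Lambda> = \<delta> / 16 + 4 * \<tau> * (ln (64 * \<tau>) + L)"
    define R where "R = (1 + L)\<^sup>2 / \<delta>"
    have D: "0 \<le> D" by (simp add: D_def log_size_nonneg)
    have P: "1 \<le> P" by (simp add: P_def divisor_prod_ge_1)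
    have L: "0 \<le> L" using \<delta> by (simp add: L_def)
    have \<Lambda>: "0 \<le> \<Lambda>" using \<delta> L ln64 assms by (simp add: \<Lambda>_def)
    have R1: "(1 + L)\<^sup>2 \<le> R"
      using \<delta> by (simp add: R_def field_simps mult_left_le_one_le)
    have R2: "1 + L \<le> (1 + L)\<^sup>2"
      using L by (simp add: power2_eq_square algebra_simps)
    have R3: "1 \<le> R" "1 + L \<le> R" using R1 R2 L by linarith+
    have poly: "a * ln (2 + 5 * D) \<le> \<delta> / 10 + \<delta> * D / 4 + a * (ln (20 * a) + L)"
    proof -
      \<comment> \<open>The scale \<open>20 * a / \<delta>\<close> makes the term in
        \<open>D\<close> exactly \<open>\<delta> * D / 4\<close>.\<close>
      have "ln (2 + 5 * D) \<le> (2 + 5 * D) / (20 * a / \<delta>) + ln (20 * a / \<delta>)"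
        using a \<delta> D by (intro ln_le_linear) auto
      also have "ln (20 * a / \<delta>) = ln (20 * a) + L"
        using a \<delta> by (simp add: L_def ln_div)
      finally have "a * ln (2 + 5 * D) \<le> a * ((2 + 5 * D) / (20 * a / \<delta>) + (ln (20 * a) + L))"
        using a by (intro mult_left_mono) auto
      also have "\<dots> = \<delta> / 10 + \<delta> * D / 4 + a * (ln (20 * a) + L)"
        using a \<delta> by (simp add: field_simps)
      finally show ?thesis .
    qed
    \<comment> \<open>Here \<open>\<epsilon> = \<delta> / 8\<close>. The scale
      \<open>64 * \<tau> / \<delta>\<close> turns \<open>4 * \<tau> * ln (1 + y)\<close> into
      \<open>\<delta> * (1 + y) / 16\<close> plus logarithms; all that is constant in
      \<open>y\<close> forms \<Lambda>.\<close>
    have prod: "2 * \<tau> * ln P \<le> 2 * (\<delta> / 8) * D + \<Lambda> * (2 * \<Lambda> / (\<delta> / 8) + 1)"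
      unfolding P_def D_def
    proof (rule divisor_prod_exp_bound[OF fin _ \<Lambda>])
      fix y :: real assume y: "0 \<le> y"
      have "ln (1 + y\<^sup>2) \<le> ln ((1 + y)\<^sup>2)"
        using y by (subst ln_le_cancel_iff) (auto simp: power2_eq_square algebra_simps add_pos_nonneg)
      also have "\<dots> = 2 * ln (1 + y)" using y by (simp add: ln_realpow)
      also have "ln (1 + y) \<le> (1 + y) / (64 * \<tau> / \<delta>) + ln (64 * \<tau> / \<delta>)"
        using y assms \<delta> by (intro ln_le_linear) auto
      also have "ln (64 * \<tau> / \<delta>) = ln (64 * \<tau>) + L"
        using assms \<delta> by (simp add: L_def ln_div)
      finally have "2 * \<tau> * ln (1 + y\<^sup>2) \<le>
          2 * \<tau> * (2 * ((1 + y) / (64 * \<tau> / \<delta>) + (ln (64 * \<tau>) + L)))"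
        using assms by (intro mult_left_mono) auto
      also have "\<dots> = \<Lambda> + \<delta> / 8 * y / 2"
        using assms \<delta> by (simp add: \<Lambda>_def field_simps)
      finally show "2 * \<tau> * ln (1 + y\<^sup>2) \<le> \<Lambda> + \<delta> / 8 * y / 2" .
    qed (use \<delta> in auto)
    have \<Lambda>_le: "\<Lambda> \<le> C1 * (1 + L)"
    proof -
      have "ln (64 * \<tau>) + L \<le> (ln (64 * \<tau>) + 1) * (1 + L)"
        using L ln64 by (simp add: algebra_simps)
      then have "4 * \<tau> * (ln (64 * \<tau>) + L) \<le> 4 * \<tau> * ((ln (64 * \<tau>) + 1) * (1 + L))"
        using assms by (intro mult_left_mono) auto
      moreover have "\<delta> / 16 \<le> 1 + L" using \<delta> L by linarith
      ultimately show ?thesis by (simp add: \<Lambda>_def C1_def algebra_simps)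
    qed
    \<comment> \<open>A number of modes of order \<open>\<Lambda> / \<delta>\<close> cost \<Lambda>
      each, and \<Lambda> is at most of order \<open>1 + L\<close>: here the squared logarithm over
      \<delta> arises.\<close>
    have \<Lambda>sq: "\<Lambda> * (2 * \<Lambda> / (\<delta> / 8) + 1) \<le> 17 * C1\<^sup>2 * R"
    proof -
      have "\<Lambda>\<^sup>2 \<le> (C1 * (1 + L))\<^sup>2" using \<Lambda> \<Lambda>_le by (intro power_mono) auto
      then have 1: "\<Lambda>\<^sup>2 / \<delta> \<le> C1\<^sup>2 * R"
        using \<delta> by (simp add: R_def divide_right_mono power_mult_distrib)
      have "C1 * 1 \<le> C1\<^sup>2" using C1 by (simp add: power2_eq_square)
      then have "C1 * (1 + L) \<le> C1\<^sup>2 * R"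
        using C1 L R3 by (intro mult_mono) auto
      then have 2: "\<Lambda> \<le> C1\<^sup>2 * R" using \<Lambda>_le by linarith
      have "\<Lambda> * (2 * \<Lambda> / (\<delta> / 8) + 1) = 16 * (\<Lambda>\<^sup>2 / \<delta>) + \<Lambda>"
        by (simp add: power2_eq_square algebra_simps)
      with 1 2 show ?thesis by linarith
    qed
    have lnB: "ln (divisor_bound \<tau> \<kappa>) = ln 4 + \<tau> * ln 10 + \<tau> * (ln 16 + 4 * ln (2 + 5 * D) + ln P)"
    proof -
      have "ln (16 * (2 + 5 * D) ^ 4 * P) = ln 16 + 4 * ln (2 + 5 * D) + ln P"
        using D P by (simp add: ln_mult ln_realpow)
      then show ?thesis
        using D P by (simp add: divisor_bound_def ln_mult ln_powr flip: D_def P_def)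
    qed
    have B: "0 < divisor_bound \<tau> \<kappa>"
      using D P by (simp add: divisor_bound_def flip: D_def P_def)
    have "ln (3 * exp (- \<delta> * D / 2) * (2 + 5 * D) * (divisor_bound \<tau> \<kappa>)\<^sup>2)
        = K0 + a * ln (2 + 5 * D) + 2 * \<tau> * ln P - \<delta> * D / 2"
      using D B by (simp add: ln_mult ln_realpow lnB) (simp add: K0_def a_def algebra_simps)
    also have "\<dots> \<le> K0 + \<delta> / 10 + a * (ln (20 * a) + L) + 17 * C1\<^sup>2 * R"
      using poly prod \<Lambda>sq by (simp add: algebra_simps)
    also have "\<dots> \<le> K0 * R + R + a * (ln (20 * a) + 1) * R + 17 * C1\<^sup>2 * R"
    proof -
      have "K0 \<le> K0 * R" using K0 R3 by (simp add: mult_le_cancel_left1)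
      moreover have "\<delta> / 10 \<le> R" using \<delta> R3 by linarith
      moreover have "a * (ln (20 * a) + L) \<le> a * ((ln (20 * a) + 1) * R)"
      proof (rule mult_left_mono)
        have "ln (20 * a) + L \<le> (ln (20 * a) + 1) * (1 + L)"
          using L a by (simp add: algebra_simps)
        also have "\<dots> \<le> (ln (20 * a) + 1) * R" using R3 a by (intro mult_left_mono) auto
        finally show "ln (20 * a) + L \<le> (ln (20 * a) + 1) * R" .
      qed (use a in auto)
      ultimately show ?thesis by (simp add: mult.assoc)
    qed
    also have "\<dots> = C * (1 + L)\<^sup>2 / \<delta>" by (simp add: C_def R_def algebra_simps add_divide_distrib)
    finally have "exp (ln (3 * exp (- \<delta> * D / 2) * (2 + 5 * D) * (divisor_bound \<tau> \<kappa>)\<^sup>2))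
        \<le> exp (C * (1 + L)\<^sup>2 / \<delta>)"
      by (simp only: exp_le_cancel_iff)
    moreover have "0 < 3 * exp (- \<delta> * D / 2) * (2 + 5 * D) * (divisor_bound \<tau> \<kappa>)\<^sup>2"
      using D B by (intro mult_pos_pos zero_less_power) auto
    ultimately have "3 * exp (- \<delta> * D / 2) * (2 + 5 * D) * (divisor_bound \<tau> \<kappa>)\<^sup>2
        \<le> exp (C * (1 + L)\<^sup>2 / \<delta>)"
      by (simp only: exp_ln)
    then have "3 * exp (- \<delta> * log_size \<kappa> / 2) * (2 + 5 * log_size \<kappa>) * (divisor_bound \<tau> \<kappa>)\<^sup>2
        \<le> exp (C * (1 + ln (1 / \<delta>))\<^sup>2 / \<delta>)"
      by (simp only: D_def L_def)
  }
  ultimately show ?thesis by blast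
qed

section \<open>Splitting off the two largest modes of a monomial\<close>

text \<open>One copy of a mode of largest modulus is taken from \<alpha> if it occurs there and from
  \<beta> otherwise; the sign \<sigma> records which.\<close>

lemma extract_largest:
  fixes \<alpha> \<beta> :: mindex
  assumes "finite (supp \<alpha> \<union> supp \<beta>)" "supp \<alpha> \<union> supp \<beta> \<noteq> {}"
  obtains n \<sigma> :: int and \<alpha>' \<beta>' :: mindex where
    "n \<in> supp \<alpha> \<union> supp \<beta>" "\<And>i. i \<in> supp \<alpha> \<union> supp \<beta> \<Longrightarrow> \<bar>i\<bar> \<le> \<bar>n\<bar>"
    "\<sigma> = 1 \<or> \<sigma> = -1" "supp \<alpha>' \<union> supp \<beta>' \<subseteq> supp \<alpha> \<union> supp \<beta>"
    "\<And>i. \<alpha> i + \<beta> i = \<alpha>' i + \<beta>' i + of_bool (i = n)"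
    "\<And>i. int (\<alpha> i) - int (\<beta> i) = int (\<alpha>' i) - int (\<beta>' i) + \<sigma> * of_bool (i = n)"
proof -
  obtain n where n: "n \<in> supp \<alpha> \<union> supp \<beta>" "\<And>i. i \<in> supp \<alpha> \<union> supp \<beta> \<Longrightarrow> \<bar>i\<bar> \<le> \<bar>n\<bar>"
  proof -
    have "Max (abs ` (supp \<alpha> \<union> supp \<beta>)) \<in> abs ` (supp \<alpha> \<union> supp \<beta>)"
      using assms by (intro Max_in) auto
    then obtain n where n: "n \<in> supp \<alpha> \<union> supp \<beta>" "Max (abs ` (supp \<alpha> \<union> supp \<beta>)) = \<bar>n\<bar>"
      by auto
    then have "\<bar>i\<bar> \<le> \<bar>n\<bar>" if "i \<in> supp \<alpha> \<union> supp \<beta>" for i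
      using Max_ge[OF finite_imageI[OF assms(1)] imageI[OF that, of abs]] by simp
    with n(1) show thesis by (rule that)
  qed
  show thesis
  proof (cases "\<alpha> n = 0")
    case False
    show thesis
      by (rule that[of n 1 "\<alpha>(n := \<alpha> n - 1)" \<beta>]) (use n False in \<open>auto simp: supp_def split: if_splits\<close>)
  next
    case True
    then have "\<beta> n \<noteq> 0" using n(1) by (auto simp: supp_def)
    then show thesis
      by (intro that[of n "-1" \<alpha> "\<beta>(n := \<beta> n - 1)"]) (use n in \<open>auto simp: supp_def split: if_splits\<close>)
  qed
qed

text \<open>After the two removals \<kappa> remains of \<alpha> + \<beta> and \<open>l'\<close> of
  \<alpha> - \<beta>; \<open>n1 = n2\<close> is possible. \<open>rest_le\<close> stands for the
  splitting of the remainder between \<alpha> and \<beta>.\<close>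

locale two_largest_modes =
  fixes \<alpha> \<beta> \<kappa> :: mindex and n1 n2 \<sigma>1 \<sigma>2 :: int and l' :: "int \<Rightarrow> int"
  assumes in_M: "(\<alpha>, \<beta>) \<in> M"
    and supp_rest: "supp \<kappa> \<subseteq> supp \<alpha> \<union> supp \<beta>"
    and mode1: "n1 \<in> supp \<alpha> \<union> supp \<beta>" and mode2: "n2 \<in> supp \<alpha> \<union> supp \<beta>"
    and sign1: "\<sigma>1 = 1 \<or> \<sigma>1 = -1" and sign2: "\<sigma>2 = 1 \<or> \<sigma>2 = -1"
    and sum_eq: "\<And>i. \<alpha> i + \<beta> i = \<kappa> i + of_bool (i = n1) + of_bool (i = n2)"
    and diff_eq: "\<And>i. int (\<alpha> i) - int (\<beta> i) = l' i + \<sigma>1 * of_bool (i = n1) + \<sigma>2 * of_bool (i = n2)"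
    and rest_le: "\<And>i. \<bar>l' i\<bar> \<le> int (\<kappa> i)"
    and largest1: "\<And>i. i \<in> supp \<alpha> \<union> supp \<beta> \<Longrightarrow> \<bar>i\<bar> \<le> \<bar>n1\<bar>"
    and largest2: "\<And>i. i \<in> supp \<kappa> \<Longrightarrow> \<bar>i\<bar> \<le> \<bar>n2\<bar>"

lemma M_finite: "(\<alpha>, \<beta>) \<in> M \<Longrightarrow> finite (supp \<alpha> \<union> supp \<beta>)"
  by (auto simp: M_def mindices_def)

lemma M_mass:
  assumes "(\<alpha>, \<beta>) \<in> M"
  shows "(\<Sum>i\<in>supp \<alpha> \<union> supp \<beta>. int (\<alpha> i) - int (\<beta> i)) = 0"
proof -
  let ?F = "supp \<alpha> \<union> supp \<beta>"
  have fin: "finite ?F" by (rule M_finite[OF assms])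
  have "deg \<alpha> = sum \<alpha> ?F" "deg \<beta> = sum \<beta> ?F"
    unfolding deg_def by (rule sum.mono_neutral_left; use fin in \<open>auto simp: supp_def\<close>)+
  moreover have "deg \<alpha> = deg \<beta>" using assms by (simp add: M_def)
  ultimately show ?thesis by (simp add: sum_subtractf flip: of_nat_sum)
qed

lemma M_momentum:
  "(\<alpha>, \<beta>) \<in> M \<Longrightarrow> (\<Sum>i\<in>supp \<alpha> \<union> supp \<beta>. i * (int (\<alpha> i) - int (\<beta> i))) = 0"
  by (simp add: M_def)

lemma two_largest_modes_exists:
  assumes "(\<alpha>, \<beta>) \<in> M" "\<alpha> \<noteq> \<beta>"
  shows "\<exists>\<kappa> n1 n2 \<sigma>1 \<sigma>2 l'. two_largest_modes \<alpha> \<beta> \<kappa> n1 n2 \<sigma>1 \<sigma>2 l'"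
proof -
  let ?F = "supp \<alpha> \<union> supp \<beta>"
  have fin: "finite ?F" by (rule M_finite[OF assms(1)])
  have "?F \<noteq> {}"
  proof
    assume "?F = {}"
    then have "\<alpha> = (\<lambda>_. 0)" "\<beta> = (\<lambda>_. 0)" by (auto simp: supp_def)
    with assms(2) show False by simp
  qed
  from extract_largest[OF fin this] obtain n1 \<sigma>1 \<alpha>1 \<beta>1 where 1:
    "n1 \<in> ?F" "\<And>i. i \<in> ?F \<Longrightarrow> \<bar>i\<bar> \<le> \<bar>n1\<bar>"
    "\<sigma>1 = 1 \<or> \<sigma>1 = -1" "supp \<alpha>1 \<union> supp \<beta>1 \<subseteq> ?F"
    "\<And>i. \<alpha> i + \<beta> i = \<alpha>1 i + \<beta>1 i + of_bool (i = n1)"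
    "\<And>i. int (\<alpha> i) - int (\<beta> i) = int (\<alpha>1 i) - int (\<beta>1 i) + \<sigma>1 * of_bool (i = n1)"
    by metis
  have fin1: "finite (supp \<alpha>1 \<union> supp \<beta>1)" using 1(4) fin by (rule finite_subset)
  \<comment> \<open>Mass conservation excludes a single mode: the total of \<alpha> - \<beta> would
    be \<sigma>1.\<close>
  have ne1: "supp \<alpha>1 \<union> supp \<beta>1 \<noteq> {}"
  proof
    assume "supp \<alpha>1 \<union> supp \<beta>1 = {}"
    then have z: "\<alpha>1 i = 0" "\<beta>1 i = 0" for i by (auto simp: supp_def)
    have "(\<Sum>i\<in>?F. int (\<alpha> i) - int (\<beta> i)) = (\<Sum>i\<in>?F. if i = n1 then \<sigma>1 else 0)"
      by (intro sum.cong) (auto simp: 1(6) z)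
    also have "\<dots> = \<sigma>1" using fin 1(1) by (simp add: sum.delta)
    finally show False using M_mass[OF assms(1)] 1(3) by auto
  qed
  from extract_largest[OF fin1 ne1] obtain n2 \<sigma>2 \<alpha>2 \<beta>2 where 2:
    "n2 \<in> supp \<alpha>1 \<union> supp \<beta>1" "\<And>i. i \<in> supp \<alpha>1 \<union> supp \<beta>1 \<Longrightarrow> \<bar>i\<bar> \<le> \<bar>n2\<bar>"
    "\<sigma>2 = 1 \<or> \<sigma>2 = -1" "supp \<alpha>2 \<union> supp \<beta>2 \<subseteq> supp \<alpha>1 \<union> supp \<beta>1"
    "\<And>i. \<alpha>1 i + \<beta>1 i = \<alpha>2 i + \<beta>2 i + of_bool (i = n2)"
    "\<And>i. int (\<alpha>1 i) - int (\<beta>1 i) = int (\<alpha>2 i) - int (\<beta>2 i) + \<sigma>2 * of_bool (i = n2)"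
    by metis
  have supp2: "supp (\<lambda>i. \<alpha>2 i + \<beta>2 i) = supp \<alpha>2 \<union> supp \<beta>2" by (auto simp: supp_def)
  have "two_largest_modes \<alpha> \<beta> (\<lambda>i. \<alpha>2 i + \<beta>2 i) n1 n2 \<sigma>1 \<sigma>2 (\<lambda>i. int (\<alpha>2 i) - int (\<beta>2 i))"
  proof
    show "(\<alpha>, \<beta>) \<in> M" by fact
    show "supp (\<lambda>i. \<alpha>2 i + \<beta>2 i) \<subseteq> ?F" unfolding supp2 using 1(4) 2(4) by blast
    show "n1 \<in> ?F" by fact
    show "n2 \<in> ?F" using 1(4) 2(1) by blast
    show "\<sigma>1 = 1 \<or> \<sigma>1 = -1" "\<sigma>2 = 1 \<or> \<sigma>2 = -1" by fact+
    fix i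
    show "\<alpha> i + \<beta> i = \<alpha>2 i + \<beta>2 i + of_bool (i = n1) + of_bool (i = n2)"
      using 1(5)[of i] 2(5)[of i] by linarith
    show "int (\<alpha> i) - int (\<beta> i)
        = int (\<alpha>2 i) - int (\<beta>2 i) + \<sigma>1 * of_bool (i = n1) + \<sigma>2 * of_bool (i = n2)"
      using 1(6)[of i] 2(6)[of i] by linarith
    show "\<bar>int (\<alpha>2 i) - int (\<beta>2 i)\<bar> \<le> int (\<alpha>2 i + \<beta>2 i)" by simp
    show "\<bar>i\<bar> \<le> \<bar>n1\<bar>" if "i \<in> ?F" using that by (rule 1(2))
    show "\<bar>i\<bar> \<le> \<bar>n2\<bar>" if "i \<in> supp (\<lambda>i. \<alpha>2 i + \<beta>2 i)"
      using that 2(2,4) unfolding supp2 by blast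
  qed
  then show ?thesis by blast
qed

section \<open>Two signed modes: size from momentum and energy, effect on the Diophantine
  product\<close>

text \<open>For equal signs the quadratic form is, up to sign, a sum of squares. For opposite signs
  it factors into \<open>m - n\<close> and \<open>m + n\<close>; two nonzero integer factors bound
  both modes, and the case \<open>m + n = 0\<close> is left to the linear form.\<close>

lemma max_abs_le_separation:
  fixes m n \<sigma> \<sigma>' :: int
  assumes "\<sigma> = 1 \<or> \<sigma> = -1" "\<sigma>' = 1 \<or> \<sigma>' = -1" and noncancel: "\<not> (m = n \<and> \<sigma> = - \<sigma>')"
  shows "max \<bar>m\<bar> \<bar>n\<bar> \<le> max (2 * \<bar>\<sigma> * m + \<sigma>' * n\<bar>) \<bar>\<sigma> * m\<^sup>2 + \<sigma>' * n\<^sup>2\<bar>"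
proof -
  have sq: "\<bar>k\<bar> \<le> k\<^sup>2" for k :: int
    using self_le_power[of "\<bar>k\<bar>" 2] by (cases "k = 0") auto
  show ?thesis
  proof (cases "\<sigma> = \<sigma>'")
    case True
    then have "\<sigma> * m\<^sup>2 + \<sigma>' * n\<^sup>2 = m\<^sup>2 + n\<^sup>2 \<or> \<sigma> * m\<^sup>2 + \<sigma>' * n\<^sup>2 = - (m\<^sup>2 + n\<^sup>2)"
      using assms(1) by auto
    then have "\<bar>\<sigma> * m\<^sup>2 + \<sigma>' * n\<^sup>2\<bar> = m\<^sup>2 + n\<^sup>2"
      by (elim disjE) (simp_all only: abs_minus_cancel abs_of_nonneg add_nonneg_nonneg zero_le_power2)
    moreover have "max \<bar>m\<bar> \<bar>n\<bar> \<le> m\<^sup>2 + n\<^sup>2"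
      using sq by (intro max.boundedI add_increasing add_increasing2) auto
    ultimately show ?thesis by (simp only: max.coboundedI2)
  next
    case False
    then have opp: "\<sigma>' = - \<sigma>" and ne: "m \<noteq> n" using assms by auto
    have 1: "\<bar>\<sigma> * m + \<sigma>' * n\<bar> = \<bar>m - n\<bar>" using assms(1) opp by auto
    have 2: "\<bar>\<sigma> * m\<^sup>2 + \<sigma>' * n\<^sup>2\<bar> = \<bar>m - n\<bar> * \<bar>m + n\<bar>"
      using assms(1) opp by (auto simp: abs_mult[symmetric] power2_eq_square algebra_simps)
    show ?thesis
    proof (cases "m + n = 0")
      case True
      then have "n = - m" by simp
      then have "max \<bar>m\<bar> \<bar>n\<bar> \<le> 2 * \<bar>m - n\<bar>" by simp
      then show ?thesis unfolding 1 by (rule max.coboundedI1)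
    next
      case False
      define p where "p = \<bar>m - n\<bar> * \<bar>m + n\<bar>"
      \<comment> \<open>Each factor is at most \<open>p\<close> in modulus, and \<open>m\<close>,
        \<open>n\<close> are half the sum and half the difference of \<open>m + n\<close> and
        \<open>m - n\<close>.\<close>
      have "\<bar>m - n\<bar> * 1 \<le> p" "1 * \<bar>m + n\<bar> \<le> p"
        unfolding p_def using ne False by (intro mult_left_mono mult_right_mono; linarith)+
      then have "max \<bar>m\<bar> \<bar>n\<bar> \<le> \<bar>m - n\<bar> * \<bar>m + n\<bar>"
        unfolding p_def[symmetric] max.bounded_iff abs_le_iff mult_1_left mult_1_right by linarith
      then show ?thesis unfolding 2 by (rule max.coboundedI2)
    qed
  qed
qed

lemma divisor_prod_mono:
  assumes "finite F" "supp x \<subseteq> F" "supp y \<subseteq> F" "\<And>j. j \<in> S \<Longrightarrow> \<bar>x j\<bar> \<le> \<bar>y j\<bar>"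
  shows "divisor_prod x \<le> divisor_prod y"
  unfolding divisor_prod_eq[OF assms(1,2)] divisor_prod_eq[OF assms(1,3)]
proof (rule prod_mono, safe)
  fix j assume "j \<in> S"
  then have "(x j)\<^sup>2 \<le> (y j)\<^sup>2" using assms(4) by (simp add: abs_le_square_iff)
  then show "1 + (x j)\<^sup>2 * (mode_height j)\<^sup>2 \<le> 1 + (y j)\<^sup>2 * (mode_height j)\<^sup>2"
    by (simp add: mult_right_mono)
qed simp

text \<open>Only the factor at \<open>n\<close> can grow. There
  \<open>(\<bar>y n\<bar> + 1)\<^sup>2 \<le> 2 * (y n)\<^sup>2 + 2\<close> and the height is at most
  \<open>H\<close>, which together cost \<open>4 * H\<^sup>2\<close>.\<close>

lemma divisor_prod_add_mode:
  assumes "finite F" "supp x \<subseteq> F" "supp y \<subseteq> F"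
    and le: "\<And>j. \<bar>x j\<bar> \<le> \<bar>y j\<bar> + of_bool (j = n)"
    and H: "1 \<le> H" "n \<in> S \<Longrightarrow> mode_height n \<le> H"
  shows "divisor_prod x \<le> 4 * H\<^sup>2 * divisor_prod y"
proof -
  have H1: "1 \<le> 4 * H\<^sup>2" using one_le_power[OF H(1), of 2] by linarith
  show ?thesis
  proof (cases "n \<in> F \<inter> S")
    case False
    have "divisor_prod x \<le> divisor_prod y"
    proof (rule divisor_prod_mono[OF assms(1-3)])
      fix j assume "j \<in> S"
      then show "\<bar>x j\<bar> \<le> \<bar>y j\<bar>"
        using False le[of j] assms(2) by (cases "j = n") (auto simp: supp_subset_iff)
    qed
    also have "1 * divisor_prod y \<le> 4 * H\<^sup>2 * divisor_prod y"
      using H1 divisor_prod_ge_1[of y] by (intro mult_right_mono) auto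
    finally show ?thesis by simp
  next
    case True
    let ?f = "\<lambda>x j. 1 + (x j)\<^sup>2 * (mode_height j)\<^sup>2 :: real"
    let ?R = "F \<inter> S - {n}"
    have fin: "finite (F \<inter> S)" using assms(1) by simp
    have "(\<Prod>j\<in>?R. ?f x j) \<le> (\<Prod>j\<in>?R. ?f y j)"
    proof (rule prod_mono, safe)
      fix j assume "j \<noteq> n"
      then have "(x j)\<^sup>2 \<le> (y j)\<^sup>2" using le[of j] by (simp add: abs_le_square_iff)
      then show "?f x j \<le> ?f y j" by (simp add: mult_right_mono)
    qed simp
    moreover have "?f x n \<le> 4 * H\<^sup>2 * ?f y n"
    proof -
      let ?h = "mode_height n"
      have h: "1 \<le> ?h\<^sup>2" "?h\<^sup>2 \<le> H\<^sup>2"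
        using mode_height_ge_1[of n] H True by (auto intro: power_mono)
      have "(x n)\<^sup>2 \<le> (\<bar>y n\<bar> + 1)\<^sup>2"
        using le[of n] power_mono[of "\<bar>x n\<bar>" "\<bar>y n\<bar> + 1" 2] by simp
      also have "\<dots> \<le> 2 * (y n)\<^sup>2 + 2"
        using zero_le_power2[of "\<bar>y n\<bar> - 1"] by (simp add: power2_sum power2_diff)
      finally have "(x n)\<^sup>2 * ?h\<^sup>2 \<le> (2 * (y n)\<^sup>2 + 2) * ?h\<^sup>2"
        by (rule mult_right_mono) simp
      also have "\<dots> \<le> (2 * (y n)\<^sup>2 + 2) * H\<^sup>2"
        using h by (intro mult_left_mono) auto
      finally have "?f x n \<le> (2 * (y n)\<^sup>2 + 3) * H\<^sup>2"
        using h by (simp add: algebra_simps)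
      also have "\<dots> \<le> (4 * (1 + (y n)\<^sup>2 * 1)) * H\<^sup>2"
        using zero_le_power2[of "y n"] by (intro mult_right_mono) auto
      also have "\<dots> \<le> (4 * ?f y n) * H\<^sup>2"
        using h by (intro mult_right_mono mult_left_mono add_left_mono) auto
      finally show ?thesis by (simp only: ac_simps)
    qed
    ultimately have "?f x n * (\<Prod>j\<in>?R. ?f x j) \<le> 4 * H\<^sup>2 * ?f y n * (\<Prod>j\<in>?R. ?f y j)"
      by (intro mult_mono prod_nonneg) (auto simp: add_nonneg_nonneg)
    then show ?thesis
      unfolding divisor_prod_eq[OF assms(1,2)] divisor_prod_eq[OF assms(1,3)]
      by (simp add: prod.remove[OF fin True] mult.assoc)
  qed
qed

section \<open>Consequences of momentum conservation and of the quadratic frequencies\<close>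

context two_largest_modes
begin

definition modes :: "int set" where "modes = supp \<alpha> \<union> supp \<beta>"

definition freq :: "int \<Rightarrow> int" where "freq i = int (\<alpha> i) - int (\<beta> i)"

lemma finite_modes: "finite modes"
  unfolding modes_def by (rule M_finite[OF in_M])

lemma supp_rest_modes: "supp \<kappa> \<subseteq> modes"
  using supp_rest by (simp add: modes_def)

lemma supp_freq: "supp freq \<subseteq> modes"
  by (auto simp: supp_def freq_def modes_def)

lemma sum_modes_delta:
  fixes f :: "int \<Rightarrow> 'b::comm_ring_1"
  shows "(\<Sum>i\<in>modes. f i * of_bool (i = n1)) = f n1" "(\<Sum>i\<in>modes. f i * of_bool (i = n2)) = f n2"
  using finite_modes mode1 mode2
  by (simp_all add: of_bool_def modes_def if_distrib sum.delta cong: if_cong)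

text \<open>With \<open>f i = i\<close> this isolates the two largest modes in the momentum, with
  \<open>f i = i\<^sup>2\<close> in the quadratic part of the divisor.\<close>

lemma sum_freq:
  "(\<Sum>i\<in>modes. f i * freq i) = (\<Sum>i\<in>modes. f i * l' i) + \<sigma>1 * f n1 + \<sigma>2 * f n2"
proof -
  have "(\<Sum>i\<in>modes. f i * freq i) = (\<Sum>i\<in>modes. f i * l' i + \<sigma>1 * (f i * of_bool (i = n1)) + \<sigma>2 * (f i * of_bool (i = n2)))"
    by (intro sum.cong) (auto simp: freq_def diff_eq algebra_simps)
  then show ?thesis by (simp add: sum.distrib sum_modes_delta flip: sum_distrib_left)
qed

lemma sum_degree:
  fixes f :: "int \<Rightarrow> real"
  shows "(\<Sum>i\<in>modes. real (\<alpha> i + \<beta> i) * f i) = (\<Sum>i\<in>modes. real (\<kappa> i) * f i) + f n1 + f n2"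
proof -
  have "(\<Sum>i\<in>modes. real (\<alpha> i + \<beta> i) * f i)
      = (\<Sum>i\<in>modes. real (\<kappa> i) * f i + f i * of_bool (i = n1) + f i * of_bool (i = n2))"
    by (intro sum.cong) (auto simp: sum_eq algebra_simps)
  then show ?thesis by (simp add: sum.distrib sum_modes_delta)
qed

text \<open>Momentum writes \<open>n1\<close>, up to sign, as a combination of \<open>n2\<close> and
  the modes of \<kappa>, all of modulus at most \<open>\<bar>n2\<bar>\<close>. Hence
  \<open>\<bar>n1\<bar> \<le> \<bar>n2\<bar> * (1 + N)\<close> with \<open>N\<close> the degree of
  \<kappa>.\<close>

lemma largest_le_second:
  "ln (fbr n1) \<le> ln (fbr n2) + ln 3 + log_size \<kappa> / 2"
proof -
  let ?N = "\<Sum>i\<in>modes. real (\<kappa> i)"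
  have "\<sigma>1 * n1 + \<sigma>2 * n2 + (\<Sum>i\<in>modes. i * l' i) = 0"
    using sum_freq[of "\<lambda>i. i"] M_momentum[OF in_M] by (simp add: freq_def modes_def)
  then have "\<bar>n1\<bar> \<le> \<bar>n2\<bar> + \<bar>\<Sum>i\<in>modes. i * l' i\<bar>"
    using sign1 sign2 by auto
  also have "\<bar>\<Sum>i\<in>modes. i * l' i\<bar> \<le> (\<Sum>i\<in>modes. \<bar>i\<bar> * int (\<kappa> i))"
    by (rule order_trans[OF sum_abs]) (auto intro!: sum_mono mult_left_mono rest_le simp: abs_mult)
  also have "\<dots> \<le> (\<Sum>i\<in>modes. \<bar>n2\<bar> * int (\<kappa> i))"
  proof (rule sum_mono)
    fix i
    show "\<bar>i\<bar> * int (\<kappa> i) \<le> \<bar>n2\<bar> * int (\<kappa> i)"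
      using largest2[of i] by (cases "\<kappa> i = 0") (auto simp: supp_def)
  qed
  finally have "real_of_int \<bar>n1\<bar> \<le> real_of_int (\<bar>n2\<bar> + (\<Sum>i\<in>modes. \<bar>n2\<bar> * int (\<kappa> i)))"
    by (simp only: of_int_le_iff)
  also have "\<dots> = \<bar>real_of_int n2\<bar> * (1 + ?N)"
    by (simp add: sum_distrib_left algebra_simps)
  also have "\<dots> \<le> fbr n2 * (1 + ?N)"
    by (intro mult_right_mono fbr_ge_abs) (auto intro!: add_nonneg_nonneg sum_nonneg)
  finally have "\<bar>real_of_int n1\<bar> \<le> fbr n2 * (1 + ?N)" by simp
  \<comment> \<open>Covers the case in which \<open>fbr n1\<close> takes its floor value 2.\<close>
  moreover have "2 * 1 \<le> fbr n2 * (1 + ?N)"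
    by (intro mult_mono fbr_ge_2) (auto intro!: sum_nonneg order_trans[OF _ fbr_ge_2])
  ultimately have "fbr n1 \<le> fbr n2 * (1 + ?N)" by (simp add: fbr_def)
  also have "\<dots> \<le> fbr n2 * (3 * exp (log_size \<kappa> / 2))"
  proof (rule mult_left_mono)
    \<comment> \<open>\<open>?N\<close> is at most \<open>3 / 2\<close> of the logarithmic size, so
      an exponential in half of that size suffices; the other half survives as the gain in
      \<open>weight_ratio_le\<close>.\<close>
    have "1 + ?N \<le> 3 * (1 + log_size \<kappa> / 2)"
      using total_degree_le_log_size[OF finite_modes supp_rest_modes] by (simp add: field_simps)
    also have "\<dots> \<le> 3 * exp (log_size \<kappa> / 2)"
      by (intro mult_left_mono exp_ge_add_one_self) auto
    finally show "1 + ?N \<le> 3 * exp (log_size \<kappa> / 2)" .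
  qed (simp add: fbr_pos less_imp_le)
  finally have "ln (fbr n1) \<le> ln (fbr n2 * (3 * exp (log_size \<kappa> / 2)))"
    using fbr_pos by (subst ln_le_cancel_iff) auto
  then show ?thesis using fbr_pos[of n2] by (simp add: ln_mult)
qed

text \<open>As \<open>j\<close> is no larger than \<open>n1\<close>, the excess of
  \<open>2 * ln (fbr j)\<close> over the logarithms of \<open>n1\<close> and \<open>n2\<close> is at
  most \<open>ln 3 + log_size \<kappa> / 2\<close>, against a full \<open>log_size \<kappa>\<close>
  from the remainder.\<close>

lemma weight_ratio_le:
  assumes "0 < \<delta>" "\<delta> < 1" "j \<in> modes"
  shows "exp (\<delta> * (2 * ln (fbr j) - log_size (\<lambda>i. \<alpha> i + \<beta> i))) \<le> 3 * exp (- \<delta> * log_size \<kappa> / 2)"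
proof -
  have "supp (\<lambda>i. \<alpha> i + \<beta> i) \<subseteq> modes" by (auto simp: supp_def modes_def)
  then have "log_size (\<lambda>i. \<alpha> i + \<beta> i) = (\<Sum>i\<in>modes. real (\<alpha> i + \<beta> i) * ln (fbr i))"
    by (rule log_size_eq[OF finite_modes])
  also have "\<dots> = log_size \<kappa> + ln (fbr n1) + ln (fbr n2)"
    by (simp only: sum_degree log_size_eq[OF finite_modes supp_rest_modes])
  finally have size: "log_size (\<lambda>i. \<alpha> i + \<beta> i) = log_size \<kappa> + ln (fbr n1) + ln (fbr n2)" .
  have "fbr j \<le> fbr n1" using assms(3) largest1 by (intro fbr_mono) (simp add: modes_def)
  then have "ln (fbr j) \<le> ln (fbr n1)" using fbr_pos by simp
  then have "2 * ln (fbr j) - log_size (\<lambda>i. \<alpha> i + \<beta> i) \<le> ln 3 - log_size \<kappa> / 2"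
    using largest_le_second unfolding size by linarith
  then have "\<delta> * (2 * ln (fbr j) - log_size (\<lambda>i. \<alpha> i + \<beta> i)) \<le> \<delta> * (ln 3 - log_size \<kappa> / 2)"
    using assms by (intro mult_left_mono) auto
  also have "\<dots> \<le> ln 3 + (- \<delta> * log_size \<kappa> / 2)"
    using assms by (simp add: right_diff_distrib mult_left_le_one_le)
  finally have "exp (\<delta> * (2 * ln (fbr j) - log_size (\<lambda>i. \<alpha> i + \<beta> i))) \<le> exp (ln 3 + (- \<delta> * log_size \<kappa> / 2))"
    by (simp only: exp_le_cancel_iff)
  then show ?thesis by (simp only: exp_add exp_ln zero_less_numeral)
qed

lemma sum_abs_freq_le: "(\<Sum>i\<in>modes. real_of_int \<bar>freq i\<bar>) \<le> 2 + (\<Sum>i\<in>modes. real (\<kappa> i))"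
proof -
  have "(\<Sum>i\<in>modes. real_of_int \<bar>freq i\<bar>) \<le> (\<Sum>i\<in>modes. real (\<alpha> i + \<beta> i) * 1)"
    by (intro sum_mono) (auto simp: freq_def)
  also have "\<dots> = (\<Sum>i\<in>modes. real (\<kappa> i) * 1) + 1 + 1" by (rule sum_degree)
  finally show ?thesis by simp
qed

lemma freq_dot_modes: "freq_dot \<omega> freq = (\<Sum>i\<in>modes. \<omega> i * real_of_int (freq i))"
  unfolding freq_dot_def
  by (rule sum.mono_neutral_left[OF finite_modes supp_freq]) (auto simp: supp_def)

text \<open>Away from a cancellation of the two largest modes, momentum conservation (when
  \<open>n1 = - n2\<close>) or the approximate conservation of \<open>\<Sum>i\<^sup>2 l\<^sub>i\<close> (otherwise) bounds them by the
  remaining modes.\<close>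

lemma largest_modes_le:
  assumes \<omega>: "\<omega> \<in> Q" and small: "\<bar>freq_dot \<omega> freq\<bar> < 1"
    and noncancel: "\<not> (n1 = n2 \<and> \<sigma>1 = - \<sigma>2)"
  shows "max \<bar>real_of_int n1\<bar> \<bar>real_of_int n2\<bar> \<le> exp (ln 4 + 3 * log_size \<kappa>)"
proof -
  let ?N = "\<Sum>i\<in>modes. real (\<kappa> i)"
  let ?B = "\<Sum>i\<in>modes. real (\<kappa> i) * (fbr i)\<^sup>2"
  have sq_le: "(real_of_int i)\<^sup>2 \<le> (fbr i)\<^sup>2" for i
    using fbr_ge_abs[of i] fbr_pos[of i] by (simp add: abs_le_square_iff[symmetric])
  have abs_le: "\<bar>real_of_int i\<bar> \<le> (fbr i)\<^sup>2" and one_le: "1 \<le> (fbr i)\<^sup>2" for i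
  proof -
    have "fbr i \<le> (fbr i)\<^sup>2"
      using fbr_ge_2[of i] by (simp add: power2_eq_square)
    then show "\<bar>real_of_int i\<bar> \<le> (fbr i)\<^sup>2" "1 \<le> (fbr i)\<^sup>2"
      using fbr_ge_abs[of i] fbr_ge_2[of i] by linarith+
  qed
  \<comment> \<open>Used for \<open>f i = i\<close> and \<open>f i = i\<^sup>2\<close>: the same sum
    \<open>?B\<close> bounds the momentum and the energy of the remaining modes.\<close>
  have rest: "\<bar>real_of_int (\<Sum>i\<in>modes. f i * l' i)\<bar> \<le> ?B"
    if "\<And>i. \<bar>real_of_int (f i)\<bar> \<le> (fbr i)\<^sup>2" for f
  proof -
    have "\<bar>real_of_int (\<Sum>i\<in>modes. f i * l' i)\<bar> \<le> (\<Sum>i\<in>modes. \<bar>real_of_int (f i * l' i)\<bar>)"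
      by (simp only: of_int_sum sum_abs)
    also have "\<dots> \<le> ?B"
    proof (rule sum_mono)
      fix i
      have "\<bar>real_of_int (l' i)\<bar> \<le> real (\<kappa> i)"
        using rest_le[of i] by linarith
      then have "\<bar>real_of_int (l' i)\<bar> * \<bar>real_of_int (f i)\<bar> \<le> real (\<kappa> i) * (fbr i)\<^sup>2"
        using that by (intro mult_mono) auto
      then show "\<bar>real_of_int (f i * l' i)\<bar> \<le> real (\<kappa> i) * (fbr i)\<^sup>2"
        by (simp add: abs_mult mult.commute)
    qed
    finally show ?thesis .
  qed
  have N_le: "?N \<le> ?B"
    using one_le by (intro sum_mono) (simp add: mult_le_cancel_left1)
  have momentum: "\<bar>real_of_int (\<sigma>1 * n1 + \<sigma>2 * n2)\<bar> \<le> ?B"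
  proof -
    have "(\<Sum>i\<in>modes. i * l' i) = - (\<sigma>1 * n1 + \<sigma>2 * n2)"
      using sum_freq[of "\<lambda>i. i"] M_momentum[OF in_M] by (simp add: freq_def modes_def)
    then show ?thesis using rest[of "\<lambda>i. i"] abs_le by simp
  qed
  have energy: "\<bar>real_of_int (\<sigma>1 * n1\<^sup>2 + \<sigma>2 * n2\<^sup>2)\<bar> \<le> 2 + ?N / 2 + ?B"
  proof -
    \<comment> \<open>The deviation of \<omega> from the squares, at most \<open>1 / 2\<close> per
      unit of \<open>freq\<close>, hence at most \<open>1 + ?N / 2\<close>. The other 1 in the
      claimed bound comes from \<open>small\<close>.\<close>
    let ?E = "\<Sum>i\<in>modes. (\<omega> i - (real_of_int i)\<^sup>2) * real_of_int (freq i)"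
    have "freq_dot \<omega> freq = ?E + real_of_int (\<Sum>i\<in>modes. i\<^sup>2 * freq i)"
      by (simp add: freq_dot_modes algebra_simps sum.distrib[symmetric])
    also have "(\<Sum>i\<in>modes. i\<^sup>2 * freq i)
        = (\<Sum>i\<in>modes. i\<^sup>2 * l' i) + (\<sigma>1 * n1\<^sup>2 + \<sigma>2 * n2\<^sup>2)"
      using sum_freq[of "\<lambda>i. i\<^sup>2"] by simp
    finally have "freq_dot \<omega> freq = ?E + real_of_int (\<Sum>i\<in>modes. i\<^sup>2 * l' i)
        + real_of_int (\<sigma>1 * n1\<^sup>2 + \<sigma>2 * n2\<^sup>2)" by (simp only: of_int_add add.assoc)
    moreover have "\<bar>real_of_int (\<Sum>i\<in>modes. i\<^sup>2 * l' i)\<bar> \<le> ?B"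
      by (rule rest) (simp add: sq_le)
    moreover have "\<bar>?E\<bar> \<le> 1 + ?N / 2"
    proof -
      have "\<bar>?E\<bar> \<le> (\<Sum>i\<in>modes. \<bar>(\<omega> i - (real_of_int i)\<^sup>2) * real_of_int (freq i)\<bar>)"
        by (rule sum_abs)
      also have "\<dots> \<le> (\<Sum>i\<in>modes. 1 / 2 * real_of_int \<bar>freq i\<bar>)"
      proof (rule sum_mono)
        fix i
        have "\<bar>\<omega> i - (real_of_int i)\<^sup>2\<bar> \<le> 1 / 2" using \<omega> by (auto simp: Q_def intro: less_imp_le)
        then show "\<bar>(\<omega> i - (real_of_int i)\<^sup>2) * real_of_int (freq i)\<bar> \<le> 1 / 2 * real_of_int \<bar>freq i\<bar>"
          unfolding abs_mult of_int_abs by (intro mult_right_mono) auto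
      qed
      also have "\<dots> \<le> 1 / 2 * (2 + ?N)"
        unfolding sum_distrib_left[symmetric] using sum_abs_freq_le by (intro mult_left_mono) auto
      also have "\<dots> = 1 + ?N / 2" by simp
      finally show ?thesis .
    qed
    moreover have "\<bar>y\<bar> \<le> 2 + N / 2 + b"
      if "x = e + a + y" "\<bar>a\<bar> \<le> b" "\<bar>e\<bar> \<le> 1 + N / 2" "\<bar>x\<bar> < 1" for x e a y b N :: real
      using that by linarith
    ultimately show ?thesis using small by blast
  qed
  have B: "0 \<le> ?B" by (simp add: sum_nonneg)
  have "max \<bar>real_of_int n1\<bar> \<bar>real_of_int n2\<bar> = real_of_int (max \<bar>n1\<bar> \<bar>n2\<bar>)"
    by (simp only: of_int_max of_int_abs)
  also have "\<dots> \<le> real_of_int (max (2 * \<bar>\<sigma>1 * n1 + \<sigma>2 * n2\<bar>) (\<bar>\<sigma>1 * n1\<^sup>2 + \<sigma>2 * n2\<^sup>2\<bar>))"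
    using max_abs_le_separation[OF sign1 sign2 noncancel] by (simp only: of_int_le_iff)
  also have "\<dots> = max (2 * \<bar>real_of_int (\<sigma>1 * n1 + \<sigma>2 * n2)\<bar>)
      (\<bar>real_of_int (\<sigma>1 * n1\<^sup>2 + \<sigma>2 * n2\<^sup>2)\<bar>)"
    by (simp only: of_int_max of_int_abs of_int_mult[of 2] of_int_numeral)
  also have "\<dots> \<le> 4 * (1 + ?B)"
  proof (rule max.boundedI)
    show "2 * \<bar>real_of_int (\<sigma>1 * n1 + \<sigma>2 * n2)\<bar> \<le> 4 * (1 + ?B)"
      by (rule order_trans[OF mult_left_mono[OF momentum]]) (use B in auto)
    show "\<bar>real_of_int (\<sigma>1 * n1\<^sup>2 + \<sigma>2 * n2\<^sup>2)\<bar> \<le> 4 * (1 + ?B)"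
      unfolding distrib_left by (rule order_trans[OF energy]) (use B N_le in linarith)
  qed
  also have "\<dots> \<le> exp (ln 4 + 3 * log_size \<kappa>)"
    using one_plus_square_sum_le_exp[OF finite_modes supp_rest_modes] by (simp add: exp_add)
  finally show ?thesis .
qed

text \<open>If the two largest modes cancel, only \<open>l'\<close> is left, and \<kappa> dominates
  it. Otherwise both have height at most \<open>?H\<close>, and restoring them one at a time costs
  \<open>4 * ?H\<^sup>2\<close> each.\<close>

lemma divisor_prod_freq_le:
  assumes "\<omega> \<in> Q" "\<bar>freq_dot \<omega> freq\<bar> < 1"
  shows "divisor_prod (\<lambda>i. real_of_int (freq i))
    \<le> 16 * (2 + 5 * log_size \<kappa>) ^ 4 * divisor_prod (\<lambda>i. real (\<kappa> i))"
proof -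
  let ?P = "divisor_prod (\<lambda>i. real (\<kappa> i))" and ?H = "2 + 5 * log_size \<kappa>"
  have D: "0 \<le> log_size \<kappa>" by (rule log_size_nonneg)
  have supp_real: "supp (\<lambda>i. real_of_int (freq i)) \<subseteq> modes" "supp (\<lambda>i. real (\<kappa> i)) \<subseteq> modes"
    using supp_freq supp_rest_modes by (auto simp: supp_def)
  have rest_le_real: "\<bar>real_of_int (l' i)\<bar> \<le> real (\<kappa> i)" for i
    using rest_le[of i] by linarith
  show ?thesis
  proof (cases "n1 = n2 \<and> \<sigma>1 = - \<sigma>2")
    case True
    then have "freq = l'" by (auto simp: freq_def diff_eq)
    then have "divisor_prod (\<lambda>i. real_of_int (freq i)) \<le> ?P"
      using rest_le_real by (intro divisor_prod_mono[OF finite_modes supp_real]) simp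
    also have "1 * ?P \<le> 16 * ?H ^ 4 * ?P"
      using D one_le_power[of ?H 4] divisor_prod_ge_1[of "\<lambda>i. real (\<kappa> i)"]
      by (intro mult_right_mono) linarith+
    finally show ?thesis by simp
  next
    case False
    have height: "mode_height n \<le> ?H" if "n \<in> S" "n = n1 \<or> n = n2" for n
    proof (rule mode_height_le[OF that(1)])
      show "\<bar>real_of_int n\<bar> \<le> exp (ln 4 + 3 * log_size \<kappa>)"
        using largest_modes_le[OF assms False] that(2) by auto
      \<comment> \<open>Division by \<open>ln 2\<close> turns \<open>ln 4\<close> into 2 and
        \<open>3 * log_size \<kappa>\<close> into at most \<open>5 * log_size \<kappa>\<close>,
        because \<open>5 * ln 2 \<ge> 10 / 3\<close>.\<close>
      have "ln 4 = 2 * ln (2::real)" using ln_realpow[of 2 2] by simp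
      moreover have "3 * log_size \<kappa> \<le> (2 / 3 * 5) * log_size \<kappa>" using D by simp
      moreover have "\<dots> \<le> (ln 2 * 5) * log_size \<kappa>"
        using ln2_ge_two_thirds D by (intro mult_right_mono) auto
      ultimately show "(ln 4 + 3 * log_size \<kappa>) / ln 2 \<le> ?H"
        by (simp add: field_simps)
    qed (use D in auto)
    \<comment> \<open>Intermediate vector between \<kappa> and \<open>freq\<close>, with only
      \<open>n2\<close> restored.\<close>
    let ?y = "\<lambda>i. real (\<kappa> i) + of_bool (i = n2)"
    have supp_y: "supp ?y \<subseteq> modes"
      using mode2 supp_real(2) by (auto simp: supp_def modes_def split: if_splits)
    have "divisor_prod (\<lambda>i. real_of_int (freq i)) \<le> 4 * ?H\<^sup>2 * divisor_prod ?y"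
    proof (rule divisor_prod_add_mode[OF finite_modes supp_real(1) supp_y])
      fix i
      show "\<bar>real_of_int (freq i)\<bar> \<le> \<bar>?y i\<bar> + of_bool (i = n1)"
        using rest_le_real[of i] sign1 sign2 by (auto simp: freq_def diff_eq)
    qed (use D height in auto)
    also have "divisor_prod ?y \<le> 4 * ?H\<^sup>2 * ?P"
      by (rule divisor_prod_add_mode[OF finite_modes supp_y supp_real(2)]) (use D height in auto)
    also have "4 * ?H\<^sup>2 * (4 * ?H\<^sup>2 * ?P) = 16 * ?H ^ 4 * ?P"
      by (simp add: power_mult_distrib flip: power_add)
    finally show ?thesis by (simp add: mult_left_mono)
  qed
qed

end

section \<open>Lower bounds for the divisors\<close>

lemma S_memberships: "0 \<notin> S" "1 \<in> S" "2 \<in> S"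
proof -
  show "0 \<notin> S" by (auto simp: S_def)
  have "(1::int) = 2 ^ 0" "(2::int) = 2 ^ 1" by simp_all
  then show "1 \<in> S" "2 \<in> S" unfolding S_def by (metis rangeI)+
qed

text \<open>Test the Diophantine condition on \<open>e\<^sub>0 - 2 e\<^sub>1 + e\<^sub>2\<close>.\<close>

lemma diophantine_gamma_le:
  assumes "\<omega> \<in> diophantine \<tau> \<gamma>"
  shows "\<gamma> \<le> 4 * 10 powr \<tau>"
proof -
  define l :: "int \<Rightarrow> int" where "l = (\<lambda>j. if j = 1 then -2 else if j = 0 \<or> j = 2 then 1 else 0)"
  have supp: "supp l = {0, 1, 2}" by (auto simp: supp_def l_def)
  have supp_S: "supp l \<inter> S = {1, 2}" "supp l - S = {0}"
    using S_memberships by (auto simp: supp)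
  have l: "l 0 = 1" "l 1 = -2" "l 2 = 1" by (simp_all add: l_def)
  have "finite (supp l) \<and> 0 < (\<Sum>j\<in>supp l. \<bar>l j\<bar>) \<and> (\<Sum>j\<in>supp l - S. \<bar>l j\<bar>) \<le> 2
      \<and> (\<Sum>j\<in>supp l. j * l j) = 0 \<and> (\<Sum>j\<in>supp l. l j) = 0"
    unfolding supp_S(2) unfolding supp by (simp add: l)
  then have "\<gamma> * (\<Prod>j\<in>supp l \<inter> S.
      1 / (1 + \<bar>real_of_int (l j)\<bar>\<^sup>2 * (jap (log 2 (real_of_int j)))\<^sup>2) powr \<tau>) \<le> \<bar>freq_dot \<omega> l\<bar>"
    using assms unfolding diophantine_def by blast
  \<comment> \<open>Both modes 1 and 2 have height 1, with entries -2 and 1, so the factors are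
    \<open>1 + 4\<close> and \<open>1 + 1\<close>. The squares give the divisor the value
    \<open>0 - 2 + 4\<close>, and the four units of \<open>l\<close> deviate by less than
    \<open>1 / 2\<close> each.\<close>
  then have "\<gamma> * (1 / 5 powr \<tau> * (1 / 2 powr \<tau>)) \<le> \<bar>freq_dot \<omega> l\<bar>"
    unfolding supp_S by (simp add: l jap_def)
  also have "\<bar>freq_dot \<omega> l\<bar> = \<bar>\<omega> 0 - 2 * \<omega> 1 + \<omega> 2\<bar>"
    by (simp add: freq_dot_def supp l)
  also have "\<dots> \<le> 4"
  proof -
    have Q: "\<omega> j - (real_of_int j)\<^sup>2 < 1 / 2" "(real_of_int j)\<^sup>2 - \<omega> j < 1 / 2" for j
      using assms unfolding diophantine_def Q_def abs_less_iff by auto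
    show ?thesis
      using Q[of 0] Q[of 1] Q[of 2] by (simp add: abs_le_iff)
  qed
  also have "1 / 5 powr \<tau> * (1 / 2 powr \<tau>) = 1 / (10 :: real) powr \<tau>"
    by (simp flip: powr_mult)
  finally show ?thesis by (simp add: field_simps)
qed

lemma divisor_bound_ge: "4 * 10 powr \<tau> \<le> divisor_bound \<tau> \<kappa>" if "0 \<le> \<tau>"
proof -
  have 1: "1 \<le> 16 * (2 + 5 * log_size \<kappa>) ^ 4"
    using log_size_nonneg[of \<kappa>] one_le_power[of "2 + 5 * log_size \<kappa>" 4] by linarith
  then have "1 * 1 \<le> 16 * (2 + 5 * log_size \<kappa>) ^ 4 * divisor_prod (\<lambda>j. real (\<kappa> j))"
    by (intro mult_mono divisor_prod_ge_1) linarith+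
  then have "1 \<le> (16 * (2 + 5 * log_size \<kappa>) ^ 4 * divisor_prod (\<lambda>j. real (\<kappa> j))) powr \<tau>"
    using that by (simp add: ge_one_powr_ge_zero)
  from mult_left_mono[OF this, of "4 * 10 powr \<tau>"] show ?thesis
    by (simp add: divisor_bound_def)
qed

lemma divisor_bound_ge_1: "1 \<le> divisor_bound \<tau> \<kappa>" if "0 \<le> \<tau>"
proof -
  have "(1::real) \<le> 10 powr \<tau>" using that by (simp add: ge_one_powr_ge_zero)
  then show ?thesis using divisor_bound_ge[OF that, of \<kappa>] by linarith
qed

context two_largest_modes
begin

text \<open>Membership in \<open>M\<close> supplies both conservation laws and \<open>normal\<close>
  the bound outside \<open>S\<close>, so \<alpha> - \<beta> is an admissible vector in the
  Diophantine condition.\<close>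

lemma diophantine_freq:
  assumes \<omega>: "\<omega> \<in> diophantine \<tau> \<gamma>" and ne: "\<alpha> \<noteq> \<beta>"
    and normal: "(\<Sum>i\<in>modes - S. \<alpha> i + \<beta> i) \<le> 2"
  shows "\<gamma> / divisor_prod (\<lambda>i. real_of_int (freq i)) powr \<tau> \<le> \<bar>freq_dot \<omega> freq\<bar>"
proof -
  have fin: "finite (supp freq)" using supp_freq finite_modes by (rule finite_subset)
  have sum_supp: "(\<Sum>i\<in>supp freq. f i * freq i) = (\<Sum>i\<in>modes. f i * freq i)" for f
    by (rule sum.mono_neutral_left[OF finite_modes supp_freq]) (auto simp: supp_def)
  obtain i where i: "\<alpha> i \<noteq> \<beta> i" using ne by auto
  then have "supp freq \<noteq> {}" by (auto simp: supp_def freq_def)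
  then have pos: "0 < (\<Sum>i\<in>supp freq. \<bar>freq i\<bar>)"
    using fin by (intro sum_pos) (auto simp: supp_def)
  have "(\<Sum>i\<in>supp freq - S. \<bar>freq i\<bar>) \<le> (\<Sum>i\<in>modes - S. \<bar>freq i\<bar>)"
    using supp_freq finite_modes by (intro sum_mono2) auto
  also have "\<dots> \<le> (\<Sum>i\<in>modes - S. int (\<alpha> i + \<beta> i))"
    by (intro sum_mono) (simp add: freq_def)
  also have "\<dots> \<le> 2" using normal unfolding of_nat_sum[symmetric] by linarith
  finally have normal': "(\<Sum>i\<in>supp freq - S. \<bar>freq i\<bar>) \<le> 2" .
  have mom: "(\<Sum>i\<in>supp freq. i * freq i) = 0"
    using M_momentum[OF in_M] by (simp add: sum_supp) (simp add: modes_def freq_def)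
  have mass: "(\<Sum>i\<in>supp freq. freq i) = 0"
    using sum_supp[of "\<lambda>_. 1"] M_mass[OF in_M] by (simp add: modes_def freq_def)
  have "\<gamma> * (\<Prod>j\<in>supp freq \<inter> S.
      1 / (1 + \<bar>real_of_int (freq j)\<bar>\<^sup>2 * (jap (log 2 (real_of_int j)))\<^sup>2) powr \<tau>) \<le> \<bar>freq_dot \<omega> freq\<bar>"
    using \<omega> fin pos normal' mom mass unfolding diophantine_def by blast
  also have "(\<Prod>j\<in>supp freq \<inter> S.
      1 / (1 + \<bar>real_of_int (freq j)\<bar>\<^sup>2 * (jap (log 2 (real_of_int j)))\<^sup>2) powr \<tau>)
      = 1 / divisor_prod (\<lambda>i. real_of_int (freq i)) powr \<tau>"
  proof -
    have "supp (\<lambda>i. real_of_int (freq i)) = supp freq" by (simp add: supp_def)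
    then show ?thesis
      by (simp add: divisor_prod_def prod_powr_distrib prod_dividef mode_height_def)
  qed
  finally show ?thesis by simp
qed

text \<open>Below modulus 1 the Diophantine bound applies, with its product controlled by \<kappa>.
  From modulus 1 on the inverse is at most 1, and \<open>\<gamma> \<le> 4 * 10 powr \<tau>\<close>
  brings this into the same form.\<close>

lemma small_divisor:
  assumes \<tau>: "0 \<le> \<tau>" and \<gamma>: "0 < \<gamma>" and \<omega>: "\<omega> \<in> diophantine \<tau> \<gamma>" and ne: "\<alpha> \<noteq> \<beta>"
    and normal: "(\<Sum>i\<in>modes - S. \<alpha> i + \<beta> i) \<le> 2"
  shows "freq_dot \<omega> freq \<noteq> 0"
    and "inverse \<bar>freq_dot \<omega> freq\<bar> \<le> inverse \<gamma> * divisor_bound \<tau> \<kappa>"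
proof -
  let ?w = "freq_dot \<omega> freq" and ?P = "divisor_prod (\<lambda>i. real_of_int (freq i))"
  let ?B = "16 * (2 + 5 * log_size \<kappa>) ^ 4 * divisor_prod (\<lambda>i. real (\<kappa> i))"
  have P: "1 \<le> ?P" by (rule divisor_prod_ge_1)
  have dio: "\<gamma> / ?P powr \<tau> \<le> \<bar>?w\<bar>" by (rule diophantine_freq[OF \<omega> ne normal])
  moreover have pos: "0 < \<gamma> / ?P powr \<tau>" using P \<gamma> by simp
  ultimately show w: "?w \<noteq> 0" by auto
  show "inverse \<bar>?w\<bar> \<le> inverse \<gamma> * divisor_bound \<tau> \<kappa>"
  proof (cases "\<bar>?w\<bar> < 1")
    case True
    have "\<omega> \<in> Q" using \<omega> by (simp add: diophantine_def)
    from divisor_prod_freq_le[OF this True] have "?P powr \<tau> \<le> ?B powr \<tau>"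
      using P \<tau> by (intro powr_mono2) auto
    also have "\<dots> \<le> divisor_bound \<tau> \<kappa>"
    proof -
      have "(1::real) \<le> 10 powr \<tau>" using \<tau> by (simp add: ge_one_powr_ge_zero)
      then have "1 * ?B powr \<tau> \<le> 4 * 10 powr \<tau> * ?B powr \<tau>"
        by (intro mult_right_mono) auto
      then show ?thesis by (simp add: divisor_bound_def)
    qed
    finally have "inverse \<gamma> * ?P powr \<tau> \<le> inverse \<gamma> * divisor_bound \<tau> \<kappa>"
      using \<gamma> by (intro mult_left_mono) auto
    moreover have "inverse \<bar>?w\<bar> \<le> inverse (\<gamma> / ?P powr \<tau>)"
      using dio pos by (rule le_imp_inverse_le)
    moreover have "inverse (\<gamma> / ?P powr \<tau>) = inverse \<gamma> * ?P powr \<tau>"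
      by (simp add: field_simps)
    ultimately show ?thesis by linarith
  next
    case False
    then have "inverse \<bar>?w\<bar> \<le> 1" using w by (simp add: inverse_le_1_iff)
    also have "1 \<le> inverse \<gamma> * divisor_bound \<tau> \<kappa>"
      using diophantine_gamma_le[OF \<omega>] divisor_bound_ge[OF \<tau>, of \<kappa>] \<gamma> by (simp add: field_simps)
    finally show ?thesis .
  qed
qed

end

section \<open>Hamiltonians of degree at most 0 have at most two modes outside \<open>S\<close> per
  monomial\<close>

lemma deg_eq_sum:
  assumes "finite F" "supp \<alpha> \<subseteq> F"
  shows "deg \<alpha> = sum \<alpha> F"
  unfolding deg_def by (rule sum.mono_neutral_left) (use assms in \<open>auto simp: supp_def\<close>)

text \<open>A nonzero value requires a nonvanishing summand. There \<alpha>, \<beta> and the centred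
  factor involve modes of \<open>S\<close> only, so outside \<open>S\<close> the exponents add up to
  those of \<open>a\<close> and \<open>b\<close>, of total degree at most
  \<open>d + 2\<close>.\<close>

lemma deg_part_normal_degree:
  assumes "deg_part I d G A B \<noteq> 0" "d \<le> 0" "finite F"
  shows "(\<Sum>j\<in>F - S. A j + B j) \<le> 2"
proof -
  have "\<exists>m \<alpha> \<beta> a b \<delta>. (m, \<alpha>, \<beta>, a, b, \<delta>) \<in> deg_indices d \<and> centred_coeff I \<delta> \<alpha> \<beta> a b A B \<noteq> 0"
  proof (rule ccontr)
    assume "\<not> ?thesis"
    then have "deg_part I d G A B = 0"
      unfolding deg_part_def by (intro infsum_0) auto
    with assms(1) show False by blast
  qed
  then obtain m \<alpha> \<beta> a b \<delta> where idx: "(m, \<alpha>, \<beta>, a, b, \<delta>) \<in> deg_indices d"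
    and ne: "centred_coeff I \<delta> \<alpha> \<beta> a b A B \<noteq> 0"
    by blast
  obtain k where k: "k \<le> \<delta>" "A = (\<lambda>j. k j + \<alpha> j + a j)" "B = (\<lambda>j. k j + \<beta> j + b j)"
  proof -
    have "{k. k \<le> \<delta> \<and> A = (\<lambda>j. k j + \<alpha> j + a j) \<and> B = (\<lambda>j. k j + \<beta> j + b j)} \<noteq> {}"
    proof
      assume "{k. k \<le> \<delta> \<and> A = (\<lambda>j. k j + \<alpha> j + a j) \<and> B = (\<lambda>j. k j + \<beta> j + b j)} = {}"
      then have "centred_coeff I \<delta> \<alpha> \<beta> a b A B = 0"
        unfolding centred_coeff_def by (simp only: sum.empty)
      with ne show False by blast
    qed
    then show thesis using that by blast
  qed
  have supp: "supp \<alpha> \<subseteq> S" "supp \<beta> \<subseteq> S" "supp \<delta> \<subseteq> S" "finite (supp a)" "finite (supp b)"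
    and deg: "int (2 * deg \<delta> + deg a + deg b) = d + 2"
    using idx by (auto simp: deg_indices_def mindices_def)
  have "A j + B j = a j + b j" if "j \<notin> S" for j
  proof -
    have "\<delta> j = 0" "\<alpha> j = 0" "\<beta> j = 0" using supp that by (auto simp: supp_def)
    moreover have "k j \<le> \<delta> j" using k(1) by (simp add: le_fun_def)
    ultimately show ?thesis by (simp add: k)
  qed
  then have "(\<Sum>j\<in>F - S. A j + B j) = (\<Sum>j\<in>F - S. a j + b j)" by (intro sum.cong) auto
  also have "\<dots> \<le> (\<Sum>j\<in>F \<union> supp a \<union> supp b. a j + b j)"
    using assms(3) supp by (intro sum_mono2) auto
  also have "\<dots> = deg a + deg b"
    using assms(3) supp deg_eq_sum[of "F \<union> supp a \<union> supp b" a] deg_eq_sum[of "F \<union> supp a \<union> supp b" b]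
    by (simp add: sum.distrib le_supI1 le_supI2)
  also have "\<dots> \<le> 2" using deg assms(2) by linarith
  finally show ?thesis .
qed

lemma ham_le0_range_normal_degree:
  assumes "G \<in> ham_le0_range I r p" "G \<alpha> \<beta> \<noteq> 0" "finite F"
  shows "(\<Sum>j\<in>F - S. \<alpha> j + \<beta> j) \<le> 2"
proof -
  have "G \<alpha> \<beta> = deg_part I (-2) G \<alpha> \<beta> + deg_part I (-1) G \<alpha> \<beta> + deg_part I 0 G \<alpha> \<beta>"
    using assms(1) by (auto simp: ham_le0_range_def)
  with assms(2) obtain d where "d \<le> 0" "deg_part I d G \<alpha> \<beta> \<noteq> 0"
    by (metis add_0 neg_le_0_iff_le order_refl zero_le_numeral zero_le_one)
  then show ?thesis using deg_part_normal_degree assms(3) by blast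
qed

section \<open>Comparison of the Hamiltonian norms with exponents \<open>p\<close> and
  \<open>p + \<delta>\<close>\<close>

lemma infsum_cmult_ennreal_le:
  fixes f :: "'a \<Rightarrow> ennreal"
  shows "infsum (\<lambda>x. c * f x) A \<le> c * infsum f A"
proof -
  have "sum f F \<le> infsum f A" if "finite F" "F \<subseteq> A" for F
    using that by (subst nonneg_infsum_complete) (auto intro: SUP_upper)
  then have "sum (\<lambda>x. c * f x) F \<le> c * infsum f A" if "finite F" "F \<subseteq> A" for F
    using that by (simp add: mult_left_mono flip: sum_distrib_left)
  then show ?thesis by (subst nonneg_infsum_complete) (auto intro!: SUP_least)
qed

text \<open>Each weight acquires a factor \<open>fbr i powr (- \<delta>)\<close>. The exponents
  \<open>k\<close> collect them, and the -2 at \<open>j\<close> yields the positive term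
  \<open>2 * ln (fbr j)\<close>.\<close>

lemma zpow_u_weight_add:
  assumes "finite (supp \<alpha> \<union> supp \<beta>)" "j \<in> supp \<alpha> \<union> supp \<beta>"
  defines "k \<equiv> (\<lambda>i. int (\<alpha> i) + int (\<beta> i) - (if i = j then 2 else 0))"
  shows "zpow (u_weight r (p + \<delta>)) k
    = zpow (u_weight r p) k * exp (\<delta> * (2 * ln (fbr j) - log_size (\<lambda>i. \<alpha> i + \<beta> i)))"
proof -
  let ?F = "supp \<alpha> \<union> supp \<beta>"
  \<comment> \<open>Since \<open>j\<close> lies in \<open>?F\<close>, subtracting 2 there does not
    take the support of \<open>k\<close> out of \<open>?F\<close>.\<close>
  have supp: "supp k \<subseteq> ?F" using assms(2) by (auto simp: supp_def k_def split: if_splits)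
  have zpow: "zpow x k = (\<Prod>i\<in>?F. x i powi k i)" for x
    unfolding zpow_def by (rule prod.mono_neutral_left[OF assms(1) supp]) (auto simp: supp_def)
  have "u_weight r (p + \<delta>) i = u_weight r p i * exp (- \<delta> * ln (fbr i))" for i
    using fbr_pos[of i] by (simp add: u_weight_def powr_def algebra_simps flip: exp_add)
  then have "zpow (u_weight r (p + \<delta>)) k
      = zpow (u_weight r p) k * (\<Prod>i\<in>?F. exp (- \<delta> * (real_of_int (k i) * ln (fbr i))))"
    by (simp add: zpow power_int_mult_distrib prod.distrib exp_power_int mult_ac)
  also have "(\<Prod>i\<in>?F. exp (- \<delta> * (real_of_int (k i) * ln (fbr i))))
      = exp (- \<delta> * (\<Sum>i\<in>?F. real_of_int (k i) * ln (fbr i)))"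
    by (simp only: exp_sum[OF assms(1)] sum_distrib_left)
  also have "(\<Sum>i\<in>?F. real_of_int (k i) * ln (fbr i))
      = (\<Sum>i\<in>?F. real (\<alpha> i + \<beta> i) * ln (fbr i) - (if i = j then 2 * ln (fbr i) else 0))"
    by (intro sum.cong) (auto simp: k_def algebra_simps)
  also have "\<dots> = log_size (\<lambda>i. \<alpha> i + \<beta> i) - 2 * ln (fbr j)"
  proof -
    have "supp (\<lambda>i. \<alpha> i + \<beta> i) \<subseteq> ?F" by (auto simp: supp_def)
    then show ?thesis
      using assms(1,2) by (simp only: sum_subtractf log_size_eq[OF assms(1)] sum.delta if_True)
  qed
  finally show ?thesis by (simp add: algebra_simps)
qed

lemma zpow_nonneg: "(\<And>i. 0 \<le> x i) \<Longrightarrow> 0 \<le> zpow x k"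
  by (simp add: zpow_def prod_nonneg)

text \<open>Two comparison Hamiltonians are allowed because a variation of \<omega> produces both
  the variation of \<open>G\<close> and \<open>G\<close> itself. Indices \<open>j\<close> off the
  support contribute nothing, by the factor \<open>\<alpha> j + \<beta> j\<close>.\<close>

lemma ham_norm_weight_le:
  assumes "0 \<le> r" "0 \<le> K1" "0 \<le> K2"
    and le: "\<And>\<alpha> \<beta> j. (\<alpha>, \<beta>) \<in> M \<Longrightarrow> j \<in> supp \<alpha> \<union> supp \<beta> \<Longrightarrow>
      cmod (H \<alpha> \<beta>) * exp (\<delta> * (2 * ln (fbr j) - log_size (\<lambda>i. \<alpha> i + \<beta> i)))
        \<le> K1 * cmod (H1 \<alpha> \<beta>) + K2 * cmod (H2 \<alpha> \<beta>)"
  shows "ham_norm r (p + \<delta>) H \<le> ennreal K1 * ham_norm r p H1 + ennreal K2 * ham_norm r p H2"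
proof -
  define k :: "int \<Rightarrow> mindex \<Rightarrow> mindex \<Rightarrow> int \<Rightarrow> int"
    where "k j \<alpha> \<beta> = (\<lambda>i. int (\<alpha> i) + int (\<beta> i) - (if i = j then 2 else 0))" for j \<alpha> \<beta>
  define T where "T q j H = (\<lambda>(\<alpha>, \<beta>). ennreal (cmod (H \<alpha> \<beta>) * real (\<alpha> j + \<beta> j) *
      zpow (u_weight r q) (k j \<alpha> \<beta>)))" for q j and H :: ham
  have norm: "ham_norm r q H = ennreal (1 / 2) * (SUP j. infsum (T q j H) M)" for q H
    by (simp add: ham_norm_def T_def k_def)
  have pointwise: "T (p + \<delta>) j H x \<le> ennreal K1 * T p j H1 x + ennreal K2 * T p j H2 x"
    if "x \<in> M" for j x
  proof -
    obtain \<alpha> \<beta> where x: "x = (\<alpha>, \<beta>)" by (cases x)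
    let ?z = "zpow (u_weight r p) (k j \<alpha> \<beta>)" and ?n = "real (\<alpha> j + \<beta> j)"
    have z: "0 \<le> ?z" using assms(1) by (intro zpow_nonneg) (simp add: u_weight_def)
    show ?thesis
    proof (cases "j \<in> supp \<alpha> \<union> supp \<beta>")
      case False
      then have "\<alpha> j = 0" "\<beta> j = 0" by (auto simp: supp_def)
      then show ?thesis by (simp add: T_def x)
    next
      case True
      let ?e = "exp (\<delta> * (2 * ln (fbr j) - log_size (\<lambda>i. \<alpha> i + \<beta> i)))"
      have M: "(\<alpha>, \<beta>) \<in> M" using that x by simp
      have "cmod (H \<alpha> \<beta>) * ?n * zpow (u_weight r (p + \<delta>)) (k j \<alpha> \<beta>)
          = (cmod (H \<alpha> \<beta>) * ?e) * (?n * ?z)"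
        unfolding k_def zpow_u_weight_add[OF M_finite[OF M] True] by (simp only: mult_ac)
      also have "\<dots> \<le> (K1 * cmod (H1 \<alpha> \<beta>) + K2 * cmod (H2 \<alpha> \<beta>)) * (?n * ?z)"
        using le[OF M True] z by (intro mult_right_mono) auto
      also have "\<dots> = K1 * (cmod (H1 \<alpha> \<beta>) * ?n * ?z) + K2 * (cmod (H2 \<alpha> \<beta>) * ?n * ?z)"
        by (simp add: algebra_simps)
      finally show ?thesis
        using assms(2,3) z by (simp add: T_def x ennreal_leI flip: ennreal_mult ennreal_plus)
    qed
  qed
  have "infsum (T (p + \<delta>) j H) M \<le> ennreal K1 * (SUP j. infsum (T p j H1) M)
      + ennreal K2 * (SUP j. infsum (T p j H2) M)" for j
  proof -
    have "infsum (T (p + \<delta>) j H) M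
        \<le> (\<Sum>\<^sub>\<infinity>x\<in>M. ennreal K1 * T p j H1 x + ennreal K2 * T p j H2 x)"
      by (intro infsum_mono pointwise nonneg_summable_on_complete zero_le)
    also have "\<dots> = (\<Sum>\<^sub>\<infinity>x\<in>M. ennreal K1 * T p j H1 x) + (\<Sum>\<^sub>\<infinity>x\<in>M. ennreal K2 * T p j H2 x)"
      by (intro infsum_add nonneg_summable_on_complete zero_le)
    also have "\<dots> \<le> ennreal K1 * infsum (T p j H1) M + ennreal K2 * infsum (T p j H2) M"
      by (intro add_mono infsum_cmult_ennreal_le)
    also have "\<dots> \<le> ennreal K1 * (SUP j. infsum (T p j H1) M) + ennreal K2 * (SUP j. infsum (T p j H2) M)"
      by (intro add_mono mult_left_mono SUP_upper) auto
    finally show ?thesis .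
  qed
  then have "ham_norm r (p + \<delta>) H \<le> ennreal (1 / 2) * (ennreal K1 * (SUP j. infsum (T p j H1) M)
      + ennreal K2 * (SUP j. infsum (T p j H2) M))"
    unfolding norm by (intro mult_left_mono SUP_least) auto
  then show ?thesis by (simp only: norm distrib_left mult_ac)
qed

section \<open>Size and Lipschitz variation of the inverse Lie derivative\<close>

lemma freq_dot_diff_le:
  assumes fin: "finite F" and supp: "supp l \<subseteq> F" and d: "\<And>i. \<bar>\<omega> i - \<omega>' i\<bar> \<le> d"
  shows "\<bar>freq_dot \<omega>' l - freq_dot \<omega> l\<bar> \<le> d * (\<Sum>i\<in>F. real_of_int \<bar>l i\<bar>)"
proof -
  have F: "freq_dot x l = (\<Sum>i\<in>F. x i * real_of_int (l i))" for x
    unfolding freq_dot_def by (rule sum.mono_neutral_left[OF fin supp]) (auto simp: supp_def)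
  have "\<bar>freq_dot \<omega>' l - freq_dot \<omega> l\<bar> = \<bar>\<Sum>i\<in>F. (\<omega>' i - \<omega> i) * real_of_int (l i)\<bar>"
    by (simp add: F left_diff_distrib sum_subtractf)
  also have "\<dots> \<le> (\<Sum>i\<in>F. \<bar>(\<omega>' i - \<omega> i) * real_of_int (l i)\<bar>)" by (rule sum_abs)
  also have "\<dots> \<le> (\<Sum>i\<in>F. d * real_of_int \<bar>l i\<bar>)"
    using d by (intro sum_mono) (simp add: abs_mult abs_minus_commute mult_right_mono)
  finally show ?thesis by (simp add: sum_distrib_left)
qed

text \<open>The splitting into \<kappa> and two modes depends on (\<alpha>, \<beta>) only, so it
  serves both frequencies. The second bound is for the size of an inverse divisor, the third for its
  variation in \<omega>.\<close>

lemma weighted_small_divisor: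
  fixes \<alpha> \<beta> :: mindex and \<tau> \<gamma> \<delta> E :: real and \<omega> \<omega>' :: "int \<Rightarrow> real"
  defines "l \<equiv> (\<lambda>i. int (\<alpha> i) - int (\<beta> i))" and "F \<equiv> supp \<alpha> \<union> supp \<beta>"
  assumes \<tau>: "0 \<le> \<tau>" and \<gamma>: "0 < \<gamma>" and \<delta>: "0 < \<delta>" "\<delta> < 1"
    and E: "\<forall>\<kappa>. finite (supp \<kappa>) \<longrightarrow>
      3 * exp (- \<delta> * log_size \<kappa> / 2) * (2 + 5 * log_size \<kappa>) * (divisor_bound \<tau> \<kappa>)\<^sup>2 \<le> E"
    and M: "(\<alpha>, \<beta>) \<in> M" and ne: "\<alpha> \<noteq> \<beta>" and normal: "(\<Sum>i\<in>F - S. \<alpha> i + \<beta> i) \<le> 2"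
    and \<omega>: "\<omega> \<in> diophantine \<tau> \<gamma>" "\<omega>' \<in> diophantine \<tau> \<gamma>" and j: "j \<in> F"
  defines "W \<equiv> exp (\<delta> * (2 * ln (fbr j) - log_size (\<lambda>i. \<alpha> i + \<beta> i)))"
  shows "freq_dot \<omega> l \<noteq> 0"
    and "W * inverse \<bar>freq_dot \<omega> l\<bar> \<le> inverse \<gamma> * E"
    and "W * (\<Sum>i\<in>F. real_of_int \<bar>l i\<bar>) * (inverse \<bar>freq_dot \<omega> l\<bar> * inverse \<bar>freq_dot \<omega>' l\<bar>)
      \<le> (inverse \<gamma>)\<^sup>2 * E"
proof -
  obtain \<kappa> n1 n2 \<sigma>1 \<sigma>2 l' where "two_largest_modes \<alpha> \<beta> \<kappa> n1 n2 \<sigma>1 \<sigma>2 l'"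
    using two_largest_modes_exists[OF M ne] by blast
  then interpret two_largest_modes \<alpha> \<beta> \<kappa> n1 n2 \<sigma>1 \<sigma>2 l' .
  have l: "freq = l" by (simp add: fun_eq_iff freq_def l_def)
  have F: "modes = F" by (simp add: modes_def F_def)
  let ?D = "log_size \<kappa>" and ?B = "divisor_bound \<tau> \<kappa>"
  let ?X = "3 * exp (- \<delta> * ?D / 2)" and ?L = "\<Sum>i\<in>F. real_of_int \<bar>l i\<bar>"
  have D: "0 \<le> ?D" by (rule log_size_nonneg)
  have B: "1 \<le> ?B" by (rule divisor_bound_ge_1[OF \<tau>])
  have fin: "finite (supp \<kappa>)" using supp_rest_modes finite_modes by (rule finite_subset)
  note sd = small_divisor[OF \<tau> \<gamma> _ ne normal[folded F], unfolded l]
  have W: "0 \<le> W" "W \<le> ?X"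
    using weight_ratio_le[OF \<delta> j[folded F]] by (simp_all add: W_def)
  have L: "?L \<le> 2 + 5 * ?D"
    using sum_abs_freq_le total_degree_le_log_size[OF finite_modes supp_rest_modes] D
    unfolding l F by linarith
  show "freq_dot \<omega> l \<noteq> 0" by (rule sd(1)[OF \<omega>(1)])
  have "W * inverse \<bar>freq_dot \<omega> l\<bar> \<le> ?X * (inverse \<gamma> * ?B)"
    using W by (intro mult_mono sd(2)[OF \<omega>(1)]) auto
  \<comment> \<open>Inserting \<open>2 + 5 * ?D\<close> and a second \<open>?B\<close>, both at
    least 1, lets this bound share the constant \<open>E\<close> with the next.\<close>
  also have "\<dots> = inverse \<gamma> * (?X * (1 * (?B * 1)))" by simp
  also have "\<dots> \<le> inverse \<gamma> * (?X * ((2 + 5 * ?D) * (?B * ?B)))"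
    using \<gamma> D B by (intro mult_left_mono mult_mono) auto
  also have "\<dots> = inverse \<gamma> * (?X * (2 + 5 * ?D) * ?B\<^sup>2)"
    by (simp only: power2_eq_square mult.assoc)
  also have "\<dots> \<le> inverse \<gamma> * E"
    using E[rule_format, OF fin] \<gamma> by (intro mult_left_mono) auto
  finally show "W * inverse \<bar>freq_dot \<omega> l\<bar> \<le> inverse \<gamma> * E" .
  have "W * ?L * (inverse \<bar>freq_dot \<omega> l\<bar> * inverse \<bar>freq_dot \<omega>' l\<bar>)
      \<le> ?X * (2 + 5 * ?D) * ((inverse \<gamma> * ?B) * (inverse \<gamma> * ?B))"
    using W L D \<gamma> B
    by (intro mult_mono sd(2)[OF \<omega>(1)] sd(2)[OF \<omega>(2)] mult_nonneg_nonneg) (auto intro: sum_nonneg)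
  also have "\<dots> = (inverse \<gamma>)\<^sup>2 * (?X * (2 + 5 * ?D) * ?B\<^sup>2)"
    by (simp only: power2_eq_square mult_ac)
  also have "\<dots> \<le> (inverse \<gamma>)\<^sup>2 * E"
    using E[rule_format, OF fin] by (intro mult_left_mono) auto
  finally show "W * ?L * (inverse \<bar>freq_dot \<omega> l\<bar> * inverse \<bar>freq_dot \<omega>' l\<bar>) \<le> (inverse \<gamma>)\<^sup>2 * E" .
qed

text \<open>Entries of two points of \<open>Q\<close> differ by less than 1, so the distance of
  distinct frequencies is a positive finite real, which can be cancelled in
  \<open>ennreal\<close>.\<close>

lemma dist_sup_diophantine:
  assumes "\<omega> \<in> diophantine \<tau> \<gamma>" "\<omega>' \<in> diophantine \<tau> \<gamma>" "\<omega> \<noteq> \<omega>'"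
  obtains d where "0 < d" "dist_sup \<omega> \<omega>' = ennreal d" "\<And>i. \<bar>\<omega> i - \<omega>' i\<bar> \<le> d"
proof -
  have "\<bar>\<omega> i - \<omega>' i\<bar> \<le> 1" for i
  proof -
    have Q: "x i - (real_of_int i)\<^sup>2 < 1 / 2" "(real_of_int i)\<^sup>2 - x i < 1 / 2"
      if "x \<in> diophantine \<tau> \<gamma>" for x
      using that unfolding diophantine_def Q_def abs_less_iff by auto
    show ?thesis
      using Q[OF assms(1)] Q[OF assms(2)] unfolding abs_le_iff by linarith
  qed
  then have "dist_sup \<omega> \<omega>' \<le> ennreal 1"
    unfolding dist_sup_def by (intro SUP_least ennreal_leI)
  then have fin: "dist_sup \<omega> \<omega>' < top" by (simp add: order_le_less_trans)
  have upper: "ennreal \<bar>\<omega> i - \<omega>' i\<bar> \<le> dist_sup \<omega> \<omega>'" for i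
    unfolding dist_sup_def by (rule SUP_upper) simp
  obtain d where d: "0 \<le> d" "dist_sup \<omega> \<omega>' = ennreal d"
    using fin by (cases "dist_sup \<omega> \<omega>'") auto
  have le: "\<bar>\<omega> i - \<omega>' i\<bar> \<le> d" for i using upper[of i] d by simp
  obtain i where "\<omega> i \<noteq> \<omega>' i" using assms(3) by auto
  then have "0 < d" using le[of i] by linarith
  then show thesis using that d(2) le by blast
qed

text \<open>For \<open>\<delta> \<le> 1 / 2\<close> the logarithm is at least \<open>2 / 3\<close>,
  so \<open>1 + L \<le> 3 * L\<close>, whence \<open>9 * C\<close>. As \<delta> approaches 1 the
  logarithm tends to 0 and the prefactor must take over: \<open>1 / \<delta> \<le> 2\<close> and
  \<open>L \<le> 1\<close> bound the exponent by \<open>8 * C\<close>.\<close>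

lemma exp_bound_log_square:
  fixes C \<delta> :: real
  assumes "0 \<le> C" "0 < \<delta>" "\<delta> < 1"
  defines "c \<equiv> 9 * C + 2 * exp (8 * C)"
  shows "2 * exp (C * (1 + ln (1 / \<delta>))\<^sup>2 / \<delta>) \<le> c * exp (c / \<delta> * (ln (1 / \<delta>))\<^sup>2)"
proof -
  define L where "L = ln (1 / \<delta>)"
  have L: "0 \<le> L" using assms by (simp add: L_def)
  have "1 \<le> exp (8 * C)" using assms(1) by simp
  then have c: "2 \<le> c" "9 * C \<le> c" "2 * exp (8 * C) \<le> c"
    using assms(1) unfolding c_def by linarith+
  have "2 * exp (C * (1 + L)\<^sup>2 / \<delta>) \<le> c * exp (c / \<delta> * L\<^sup>2)"
  proof (cases "\<delta> \<le> 1 / 2")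
    case True
    then have "ln 2 \<le> L" using assms(2) by (simp add: L_def field_simps)
    then have "1 + L \<le> 3 * L" using ln2_ge_two_thirds by linarith
    then have "(1 + L)\<^sup>2 \<le> (3 * L)\<^sup>2" using L by (intro power_mono) auto
    then have "C * (1 + L)\<^sup>2 \<le> C * (9 * L\<^sup>2)"
      using assms(1) by (intro mult_left_mono) (auto simp: power_mult_distrib)
    also have "\<dots> \<le> c * L\<^sup>2" using mult_right_mono[OF c(2), of "L\<^sup>2"] by simp
    finally have "C * (1 + L)\<^sup>2 / \<delta> \<le> c / \<delta> * L\<^sup>2"
      using assms(2) by (simp add: divide_right_mono)
    then show ?thesis using c by (intro mult_mono) auto
  next
    case False
    then have "1 / \<delta> \<le> 2" using assms(2) by (simp add: field_simps)
    moreover have "L \<le> 1 / \<delta> - 1" unfolding L_def using assms(2) by (intro ln_le_minus_one) simp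
    ultimately have "(1 + L)\<^sup>2 \<le> 2\<^sup>2" using L by (intro power_mono) auto
    then have "C * (1 + L)\<^sup>2 * (1 / \<delta>) \<le> (C * 2\<^sup>2) * 2"
      using \<open>1 / \<delta> \<le> 2\<close> assms by (intro mult_mono) auto
    then have "2 * exp (C * (1 + L)\<^sup>2 / \<delta>) \<le> 2 * exp (8 * C)" by simp
    also have "\<dots> \<le> c * 1" using c(3) by simp
    also have "\<dots> \<le> c * exp (c / \<delta> * L\<^sup>2)"
      using c assms(2) by (intro mult_left_mono) auto
    finally show ?thesis .
  qed
  then show ?thesis by (simp add: L_def)
qed

text \<open>Varying the divisor costs \<open>(inverse \<gamma>)\<^sup>2 * E\<close> times the sup
  norm of \<open>G\<close>. The \<gamma> in front of the Lipschitz quotient reduces this to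
  \<open>inverse \<gamma> * E\<close>, the same as the sup part contributes; hence the factor
  2.\<close>

lemma lip_norm_lie_inv_le:
  assumes \<tau>: "0 \<le> \<tau>" and \<gamma>: "0 < \<gamma>" and r: "0 < r" and \<delta>: "0 < \<delta>" "\<delta> < 1"
    and E: "\<forall>\<kappa>. finite (supp \<kappa>) \<longrightarrow>
      3 * exp (- \<delta> * log_size \<kappa> / 2) * (2 + 5 * log_size \<kappa>) * (divisor_bound \<tau> \<kappa>)\<^sup>2 \<le> E"
    and G: "\<And>\<omega>. \<omega> \<in> diophantine \<tau> \<gamma> \<Longrightarrow> G \<omega> \<in> ham_le0_range I r p"
  shows "lip_norm \<tau> \<gamma> r (p + \<delta>) (\<lambda>\<omega>. lie_inv \<omega> (G \<omega>))
    \<le> ennreal (2 * inverse \<gamma> * E) * lip_norm \<tau> \<gamma> r p G"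
proof -
  let ?\<Omega> = "diophantine \<tau> \<gamma>"
  \<comment> \<open>Testing \<open>E\<close> on the zero multi-index shows that it is
    nonnegative.\<close>
  have "0 \<le> 3 * exp (- \<delta> * log_size (\<lambda>_. 0) / 2) * (2 + 5 * log_size (\<lambda>_. 0))
      * (divisor_bound \<tau> (\<lambda>_. 0))\<^sup>2"
    using log_size_nonneg[of "\<lambda>_. 0"] by (intro mult_nonneg_nonneg) auto
  also have "\<dots> \<le> E" by (rule E[rule_format]) (simp add: supp_def)
  finally have E0: "0 \<le> E" .
  have diag: "G \<omega> \<alpha> \<alpha> = 0" if "\<omega> \<in> ?\<Omega>" for \<omega> \<alpha>
    using G[OF that] unfolding ham_le0_range_def by blast
  have single: "ham_norm r (p + \<delta>) (lie_inv \<omega> (G \<omega>)) \<le> ennreal (inverse \<gamma> * E) * ham_norm r p (G \<omega>)"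
    if \<omega>: "\<omega> \<in> ?\<Omega>" for \<omega>
  proof -
    have "ham_norm r (p + \<delta>) (lie_inv \<omega> (G \<omega>))
        \<le> ennreal (inverse \<gamma> * E) * ham_norm r p (G \<omega>) + ennreal 0 * ham_norm r p (G \<omega>)"
    proof (rule ham_norm_weight_le)
      fix \<alpha> \<beta> j assume M: "(\<alpha>, \<beta>) \<in> M" and j: "j \<in> supp \<alpha> \<union> supp \<beta>"
      let ?g = "G \<omega> \<alpha> \<beta>" and ?w = "freq_dot \<omega> (\<lambda>i. int (\<alpha> i) - int (\<beta> i))"
      let ?W = "exp (\<delta> * (2 * ln (fbr j) - log_size (\<lambda>i. \<alpha> i + \<beta> i)))"
      have "cmod (lie_inv \<omega> (G \<omega>) \<alpha> \<beta>) * ?W \<le> inverse \<gamma> * E * cmod ?g"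
      proof (cases "?g = 0")
        case False
        then have ne: "\<alpha> \<noteq> \<beta>" using diag[OF \<omega>] by auto
        have normal: "(\<Sum>i\<in>supp \<alpha> \<union> supp \<beta> - S. \<alpha> i + \<beta> i) \<le> 2"
          by (rule ham_le0_range_normal_degree[OF G[OF \<omega>] False M_finite[OF M]])
        have "cmod (lie_inv \<omega> (G \<omega>) \<alpha> \<beta>) * ?W = (?W * inverse \<bar>?w\<bar>) * cmod ?g"
          using M ne by (simp add: lie_inv_def norm_mult norm_inverse divide_inverse)
        also have "\<dots> \<le> inverse \<gamma> * E * cmod ?g"
          by (rule mult_right_mono[OF weighted_small_divisor(2)[OF \<tau> \<gamma> \<delta> E M ne normal \<omega> \<omega> j]]) auto
        finally show ?thesis .
      qed (simp add: lie_inv_def)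
      then show "cmod (lie_inv \<omega> (G \<omega>) \<alpha> \<beta>) * ?W \<le> inverse \<gamma> * E * cmod ?g + 0 * cmod ?g"
        by simp
    qed (use r \<gamma> E0 in auto)
    then show ?thesis by simp
  qed
  have pair: "ham_norm r (p + \<delta>) (\<lambda>\<alpha> \<beta>. lie_inv \<omega> (G \<omega>) \<alpha> \<beta> - lie_inv \<omega>' (G \<omega>') \<alpha> \<beta>) / dist_sup \<omega> \<omega>'
      \<le> ennreal (inverse \<gamma> * E) * (ham_norm r p (\<lambda>\<alpha> \<beta>. G \<omega> \<alpha> \<beta> - G \<omega>' \<alpha> \<beta>) / dist_sup \<omega> \<omega>')
        + ennreal ((inverse \<gamma>)\<^sup>2 * E) * ham_norm r p (G \<omega>')"
    if \<omega>: "\<omega> \<in> ?\<Omega>" "\<omega>' \<in> ?\<Omega>" "\<omega> \<noteq> \<omega>'" for \<omega> \<omega>'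
  proof -
    obtain d where d: "0 < d" "dist_sup \<omega> \<omega>' = ennreal d" "\<And>i. \<bar>\<omega> i - \<omega>' i\<bar> \<le> d"
      using dist_sup_diophantine[OF \<omega>] by blast
    let ?H = "\<lambda>\<alpha> \<beta>. lie_inv \<omega> (G \<omega>) \<alpha> \<beta> - lie_inv \<omega>' (G \<omega>') \<alpha> \<beta>"
    let ?K = "(inverse \<gamma>)\<^sup>2 * E * d"
    have "ham_norm r (p + \<delta>) ?H
        \<le> ennreal (inverse \<gamma> * E) * ham_norm r p (\<lambda>\<alpha> \<beta>. G \<omega> \<alpha> \<beta> - G \<omega>' \<alpha> \<beta>)
          + ennreal ?K * ham_norm r p (G \<omega>')"
    proof (rule ham_norm_weight_le)
      fix \<alpha> \<beta> j assume M: "(\<alpha>, \<beta>) \<in> M" and j: "j \<in> supp \<alpha> \<union> supp \<beta>"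
      define l where "l = (\<lambda>i. int (\<alpha> i) - int (\<beta> i))"
      let ?g = "G \<omega> \<alpha> \<beta>" and ?g' = "G \<omega>' \<alpha> \<beta>"
      let ?w = "freq_dot \<omega> l" and ?w' = "freq_dot \<omega>' l"
      let ?W = "exp (\<delta> * (2 * ln (fbr j) - log_size (\<lambda>i. \<alpha> i + \<beta> i)))"
      let ?L = "\<Sum>i\<in>supp \<alpha> \<union> supp \<beta>. real_of_int \<bar>l i\<bar>"
      show "cmod (?H \<alpha> \<beta>) * ?W \<le> inverse \<gamma> * E * cmod (?g - ?g') + ?K * cmod ?g'"
      proof (cases "?g = 0 \<and> ?g' = 0")
        case True
        then show ?thesis by (simp add: lie_inv_def)
      next
        case False
        then have ne: "\<alpha> \<noteq> \<beta>" using diag \<omega> by auto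
        \<comment> \<open>The normal degree depends on (\<alpha>, \<beta>) only, so it is enough
          that one of the two coefficients is nonzero.\<close>
        have normal: "(\<Sum>i\<in>supp \<alpha> \<union> supp \<beta> - S. \<alpha> i + \<beta> i) \<le> 2"
          using False ham_le0_range_normal_degree[OF G[OF \<omega>(1)] _ M_finite[OF M], of \<alpha> \<beta>]
            ham_le0_range_normal_degree[OF G[OF \<omega>(2)] _ M_finite[OF M], of \<alpha> \<beta>] by blast
        note sd = weighted_small_divisor[OF \<tau> \<gamma> \<delta> E M ne normal _ _ j, folded l_def]
        have sd3: "?W * ?L * (inverse \<bar>?w\<bar> * inverse \<bar>?w'\<bar>) \<le> (inverse \<gamma>)\<^sup>2 * E"
          using sd(3)[OF \<omega>(1,2)] by (simp only: l_def)
        have "supp l \<subseteq> supp \<alpha> \<union> supp \<beta>" by (auto simp: supp_def l_def)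
        then have diff: "\<bar>?w' - ?w\<bar> \<le> d * ?L"
          using d(3) by (rule freq_dot_diff_le[OF M_finite[OF M]])
        have w: "?w \<noteq> 0" "?w' \<noteq> 0" using sd(1) \<omega> by blast+
        have "?H \<alpha> \<beta> = ?g / (\<i> * of_real ?w) - ?g' / (\<i> * of_real ?w')"
          using M ne by (simp add: lie_inv_def l_def)
        \<comment> \<open>Separates the variation of the coefficient from that of the divisor; the
          latter is at most \<open>d * ?L\<close>.\<close>
        also have "\<dots> = (?g - ?g') / (\<i> * of_real ?w) + ?g' * of_real (?w' - ?w) / (\<i> * of_real ?w * of_real ?w')"
          using w by (simp add: field_simps)
        finally have "cmod (?H \<alpha> \<beta>) \<le> cmod ((?g - ?g') / (\<i> * of_real ?w))
            + cmod (?g' * of_real (?w' - ?w) / (\<i> * of_real ?w * of_real ?w'))"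
          by (simp only: norm_triangle_ineq)
        also have "\<dots> = inverse \<bar>?w\<bar> * cmod (?g - ?g')
            + \<bar>?w' - ?w\<bar> * ((inverse \<bar>?w\<bar> * inverse \<bar>?w'\<bar>) * cmod ?g')"
          by (simp add: norm_mult norm_inverse divide_inverse mult_ac del: of_real_diff)
        also have "\<dots> \<le> inverse \<bar>?w\<bar> * cmod (?g - ?g')
            + (d * ?L) * ((inverse \<bar>?w\<bar> * inverse \<bar>?w'\<bar>) * cmod ?g')"
          by (intro add_left_mono mult_right_mono diff) auto
        finally have "cmod (?H \<alpha> \<beta>) * ?W \<le> (inverse \<bar>?w\<bar> * cmod (?g - ?g')
            + (d * ?L) * ((inverse \<bar>?w\<bar> * inverse \<bar>?w'\<bar>) * cmod ?g')) * ?W"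
          by (rule mult_right_mono) simp
        also have "\<dots> = (?W * inverse \<bar>?w\<bar>) * cmod (?g - ?g')
            + (?W * ?L * (inverse \<bar>?w\<bar> * inverse \<bar>?w'\<bar>)) * (d * cmod ?g')"
          by (simp only: distrib_right distrib_left mult_ac)
        also have "\<dots> \<le> (inverse \<gamma> * E) * cmod (?g - ?g') + ((inverse \<gamma>)\<^sup>2 * E) * (d * cmod ?g')"
          using d(1) by (intro add_mono mult_right_mono sd(2)[OF \<omega>(1,2)] sd3) auto
        finally show ?thesis by (simp only: mult.assoc)
      qed
    qed (use r \<gamma> E0 d in auto)
    then have "ham_norm r (p + \<delta>) ?H / ennreal d
        \<le> (ennreal (inverse \<gamma> * E) * ham_norm r p (\<lambda>\<alpha> \<beta>. G \<omega> \<alpha> \<beta> - G \<omega>' \<alpha> \<beta>)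
          + ennreal ?K * ham_norm r p (G \<omega>')) / ennreal d"
      by (rule divide_right_mono_ennreal)
    also have "\<dots> = ennreal (inverse \<gamma> * E) * (ham_norm r p (\<lambda>\<alpha> \<beta>. G \<omega> \<alpha> \<beta> - G \<omega>' \<alpha> \<beta>) / ennreal d)
        + ennreal ((inverse \<gamma>)\<^sup>2 * E) * ham_norm r p (G \<omega>')"
    proof -
      \<comment> \<open>The factor \<open>d\<close> in \<open>?K\<close> cancels the distance, which
        leaves the norm at \<omega>' without a quotient.\<close>
      have "ennreal ?K * ham_norm r p (G \<omega>') / ennreal d
          = (ennreal ((inverse \<gamma>)\<^sup>2 * E) * ham_norm r p (G \<omega>')) * ennreal d / ennreal d"
        using d(1) E0 by (simp add: ennreal_mult mult_ac)
      also have "\<dots> = ennreal ((inverse \<gamma>)\<^sup>2 * E) * ham_norm r p (G \<omega>')"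
        using d(1) by (intro ennreal_mult_divide_eq) auto
      finally show ?thesis by (simp only: add_divide_distrib_ennreal ennreal_times_divide)
    qed
    finally show ?thesis by (simp only: d(2))
  qed
  define N0 where "N0 = (SUP \<omega>\<in>?\<Omega>. ham_norm r p (G \<omega>))"
  let ?P = "{(\<omega>, \<omega>'). \<omega> \<in> ?\<Omega> \<and> \<omega>' \<in> ?\<Omega> \<and> \<omega> \<noteq> \<omega>'}"
  define N1 where "N1 = (SUP (\<omega>, \<omega>')\<in>?P.
      ham_norm r p (\<lambda>\<alpha> \<beta>. G \<omega> \<alpha> \<beta> - G \<omega>' \<alpha> \<beta>) / dist_sup \<omega> \<omega>')"
  have N0: "ham_norm r p (G \<omega>) \<le> N0" if "\<omega> \<in> ?\<Omega>" for \<omega>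
    unfolding N0_def using that by (rule SUP_upper)
  have N1: "ham_norm r p (\<lambda>\<alpha> \<beta>. G \<omega> \<alpha> \<beta> - G \<omega>' \<alpha> \<beta>) / dist_sup \<omega> \<omega>' \<le> N1"
    if "\<omega> \<in> ?\<Omega>" "\<omega>' \<in> ?\<Omega>" "\<omega> \<noteq> \<omega>'" for \<omega> \<omega>'
    unfolding N1_def by (rule SUP_upper2[of "(\<omega>, \<omega>')"]) (use that in auto)
  have "(SUP \<omega>\<in>?\<Omega>. ham_norm r (p + \<delta>) (lie_inv \<omega> (G \<omega>))) \<le> ennreal (inverse \<gamma> * E) * N0"
    by (intro SUP_least order_trans[OF single] mult_left_mono N0) auto
  moreover have "ennreal \<gamma> * (SUP (\<omega>, \<omega>')\<in>?P.
      ham_norm r (p + \<delta>) (\<lambda>\<alpha> \<beta>. lie_inv \<omega> (G \<omega>) \<alpha> \<beta> - lie_inv \<omega>' (G \<omega>') \<alpha> \<beta>) / dist_sup \<omega> \<omega>')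
      \<le> ennreal \<gamma> * (ennreal (inverse \<gamma> * E) * N1 + ennreal ((inverse \<gamma>)\<^sup>2 * E) * N0)"
  proof (intro mult_left_mono SUP_least)
    fix x assume "x \<in> ?P"
    then obtain \<omega> \<omega>' where x: "x = (\<omega>, \<omega>')" "\<omega> \<in> ?\<Omega>" "\<omega>' \<in> ?\<Omega>" "\<omega> \<noteq> \<omega>'" by auto
    show "(case x of (\<omega>, \<omega>') \<Rightarrow>
        ham_norm r (p + \<delta>) (\<lambda>\<alpha> \<beta>. lie_inv \<omega> (G \<omega>) \<alpha> \<beta> - lie_inv \<omega>' (G \<omega>') \<alpha> \<beta>) / dist_sup \<omega> \<omega>')
        \<le> ennreal (inverse \<gamma> * E) * N1 + ennreal ((inverse \<gamma>)\<^sup>2 * E) * N0"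
      unfolding x(1) prod.case
      by (rule order_trans[OF pair[OF x(2-4)]]) (intro add_mono mult_left_mono N0 N1 x zero_le)
  qed simp
  ultimately have "lip_norm \<tau> \<gamma> r (p + \<delta>) (\<lambda>\<omega>. lie_inv \<omega> (G \<omega>)) \<le> ennreal (inverse \<gamma> * E) * N0
      + ennreal \<gamma> * (ennreal (inverse \<gamma> * E) * N1 + ennreal ((inverse \<gamma>)\<^sup>2 * E) * N0)"
    unfolding lip_norm_def by (rule add_mono)
  also have "\<dots> = ennreal (2 * inverse \<gamma> * E) * N0 + ennreal E * N1"
  proof -
    have "ennreal \<gamma> * ennreal (inverse \<gamma> * E) = ennreal E"
      using \<gamma> E0 by (simp flip: ennreal_mult)
    moreover have "ennreal \<gamma> * ennreal ((inverse \<gamma>)\<^sup>2 * E) = ennreal (inverse \<gamma> * E)"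
      using \<gamma> E0 by (simp add: power2_eq_square flip: ennreal_mult)
    moreover have "ennreal (2 * inverse \<gamma> * E) = ennreal (inverse \<gamma> * E) + ennreal (inverse \<gamma> * E)"
      using \<gamma> E0 by (simp flip: ennreal_plus)
    ultimately show ?thesis by (simp add: distrib_left distrib_right mult.assoc[symmetric] add_ac)
  qed
  \<comment> \<open>Enlarging the second constant to \<open>2 * E\<close> makes the sum a multiple
    of \<open>N0 + ennreal \<gamma> * N1\<close>.\<close>
  also have "\<dots> \<le> ennreal (2 * inverse \<gamma> * E) * N0 + ennreal (2 * E) * N1"
    using E0 \<gamma> by (intro add_mono mult_right_mono ennreal_leI) auto
  also have "\<dots> = ennreal (2 * inverse \<gamma> * E) * (N0 + ennreal \<gamma> * N1)"
  proof -
    have "ennreal (2 * inverse \<gamma> * E) * ennreal \<gamma> = ennreal (2 * E)"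
      using \<gamma> E0 by (simp flip: ennreal_mult)
    then show ?thesis by (simp add: distrib_left mult.assoc[symmetric])
  qed
  also have "N0 + ennreal \<gamma> * N1 = lip_norm \<tau> \<gamma> r p G"
    by (simp add: lip_norm_def N0_def N1_def)
  finally show ?thesis .
qed

section \<open>The estimate with a constant depending on \<tau> only\<close>

theorem lemma3p1:
  fixes \<tau> :: real
  assumes "\<tau> \<ge> 2"
  shows "\<exists>c>0. \<forall>\<gamma> r p :: real. \<forall>I :: int \<Rightarrow> real. \<forall>G :: (int \<Rightarrow> real) \<Rightarrow> ham.
    \<gamma> > 0 \<and> r > 0 \<and> p > 1 \<and>
    (\<forall>j. I j \<ge> 0) \<and> (\<forall>j. j \<notin> S \<longrightarrow> I j = 0) \<and>
    (\<lambda>j. complex_of_real (sqrt (I j))) \<in> wp_ball r p \<and>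
    (\<forall>\<omega>\<in>diophantine \<tau> \<gamma>. G \<omega> \<in> ham_le0_range I r p) \<and>
    lip_norm \<tau> \<gamma> r p G < \<infinity> \<longrightarrow>
    (\<forall>\<delta>::real. 0 < \<delta> \<and> \<delta> < 1 \<longrightarrow>
      lip_norm \<tau> \<gamma> r (p + \<delta>) (\<lambda>\<omega>. lie_inv \<omega> (G \<omega>))
        \<le> ennreal (c * inverse \<gamma> * exp (c / \<delta> * (ln (1 / \<delta>))\<^sup>2)) * lip_norm \<tau> \<gamma> r p G)"
proof -
  \<comment> \<open>\<open>C\<close> is chosen before \<gamma>, \<open>r\<close>, \<open>p\<close>,
    \<open>I\<close>, \<open>G\<close> and \<delta> appear, so \<open>c\<close> is a pure
    constant.\<close>
  obtain C where C: "0 \<le> C" and bound: "\<And>\<delta> \<kappa>. 0 < \<delta> \<Longrightarrow> \<delta> < 1 \<Longrightarrow> finite (supp \<kappa>) \<Longrightarrow>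
      3 * exp (- \<delta> * log_size \<kappa> / 2) * (2 + 5 * log_size \<kappa>) * (divisor_bound \<tau> \<kappa>)\<^sup>2
        \<le> exp (C * (1 + ln (1 / \<delta>))\<^sup>2 / \<delta>)"
    using divisor_bound_weight_le[of \<tau>] assms by auto
  define c where "c = 9 * C + 2 * exp (8 * C)"
  have "0 < c" using C by (simp add: c_def add_nonneg_pos)
  moreover have "lip_norm \<tau> \<gamma> r (p + \<delta>) (\<lambda>\<omega>. lie_inv \<omega> (G \<omega>))
      \<le> ennreal (c * inverse \<gamma> * exp (c / \<delta> * (ln (1 / \<delta>))\<^sup>2)) * lip_norm \<tau> \<gamma> r p G"
    if "0 < \<gamma>" "0 < r" "\<forall>\<omega>\<in>diophantine \<tau> \<gamma>. G \<omega> \<in> ham_le0_range I r p" "0 < \<delta>" "\<delta> < 1"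
    for \<gamma> r p \<delta> :: real and I :: "int \<Rightarrow> real" and G :: "(int \<Rightarrow> real) \<Rightarrow> ham"
  proof -
    let ?E = "exp (C * (1 + ln (1 / \<delta>))\<^sup>2 / \<delta>)"
    have "lip_norm \<tau> \<gamma> r (p + \<delta>) (\<lambda>\<omega>. lie_inv \<omega> (G \<omega>))
        \<le> ennreal (2 * inverse \<gamma> * ?E) * lip_norm \<tau> \<gamma> r p G"
      using that assms bound by (intro lip_norm_lie_inv_le[of \<tau> \<gamma> r \<delta> ?E]) auto
    also have "\<dots> \<le> ennreal (c * inverse \<gamma> * exp (c / \<delta> * (ln (1 / \<delta>))\<^sup>2)) * lip_norm \<tau> \<gamma> r p G"
    proof (intro mult_right_mono ennreal_leI zero_le)
      have "inverse \<gamma> * (2 * ?E) \<le> inverse \<gamma> * (c * exp (c / \<delta> * (ln (1 / \<delta>))\<^sup>2))"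
        using exp_bound_log_square[OF C that(4,5)] that(1)
        unfolding c_def by (intro mult_left_mono) auto
      then show "2 * inverse \<gamma> * ?E \<le> c * inverse \<gamma> * exp (c / \<delta> * (ln (1 / \<delta>))\<^sup>2)"
        by (simp only: mult_ac)
    qed
    finally show ?thesis .
  qed
  ultimately show ?thesis by blast
qed

end
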